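(* Let $\sigma>0$, $\mu_0,\mu_1,\mu_2,\mu_3>0$, $\rho\in(0,2]$, let $\mathcal S_2$ be either of the two operators specified in the context, and assume that $\mathcal T^{-1}(0)\neq\emptyset$. Let $u^0=(v_\Lambda^0,\xi^0,w_s^0)\in\mathcal U$ and let $\{u^k\}_{k=0}^\infty$, $u^k=(v_\Lambda^k,\xi^k,w_s^k)$, be the infinite sequence generated by the accelerated proximal ADMM: for $k=0,1,2,\dots$ $$\bar v_\Lambda^{k}=\operatorname*{argmin}_{v_\Lambda\in\mathcal V}\ \mathcal L_\sigma(v_\Lambda,\xi^k;w_s^k)+\tfrac12\|v_\Lambda-v_\Lambda^k\|_{\mathcal S_1}^2,$$ $$\bar w_s^{k}=w_s^k+\sigma(\tilde{\mathcal A}^*\xi^k+\bar v_\Lambda^{k}-\tilde r),$$ $$\bar\xi^{k}=\operatorname*{argmin}_{\xi\in\mathcal Z\times\mathcal Y}\ \mathcal L_\sigma(\bar v_\Lambda^{k},\xi;\bar w_s^{k})+\tfrac12\|\xi-\xi^k\|_{\mathcal S_2}^2,$$ $$\hat u^{k+1}=\rho\,\bar u^{k}+(1-\rho)u^k,\qquad \bar u^k=(\bar v_\Lambda^k,\bar\xi^k,\bar w_s^k),$$ $$u^{k+1}=\tfrac{1}{k+2}\,u^0+\tfrac{k+1}{k+2}\,\hat u^{k+1}.$$ Let $F:\mathcal U\to\mathcal U$ be $F(u)=(1-\rho)u+\rho(\mathcal S+\mathcal T)^{-1}\mathcal S u$. Then for all $k\ge 0$ and all $u^*\in\mathcal T^{-1}(0)$,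 $$\|u^k-F(u^k)\|_{\mathcal S}\le \frac{2\|u^0-u^*\|_{\mathcal S}}{k+1}.$$
   Context: **Problem data.** Integers $n,m,M\ge1$, $p=n+m$, and positive integers $D_1,\dots,D_m$ with $\sum_i D_i=n$. Matrices $B_1\in\mathbb R^{n\times l}$, $C\in\mathbb R^{q\times n}$, $D\in\mathbb R^{q\times m}$, and vertex system matrices $A^i\in\mathbb R^{n\times n}$, $B_2^i\in\mathbb R^{n\times m}$ ($i=1,\dots,M$) of an uncertain linear system with state matrix $A$ and input matrix $B_2$. Standing assumption: $C^\top D=0$, $D^\top D\succ0$, $(A,B_2)$ stabilizable, $(A,C)$ detectable. For $S\in\mathbb S^k$ (real symmetric $k\times k$), $\mathrm{svec}(S)=[s_{11},\sqrt2 s_{21},\dots,\sqrt2 s_{k1},s_{22},\dots,s_{kk}]^\top\in\mathbb R^{k(k+1)/2}$, and $T_k\in\mathbb R^{\frac{k(k+1)}2\times k^2}$ is the matrix with $\mathrm{svec}(S)=T_k\mathrm{vec}(S)$ for symmetric $S$ and $T_kT_k^\top=I$ ($\mathrm{vec}$ stacks columns). $\Gamma^{k(k+1)/2}=\{\mathrm{svec}(X):X\in\mathbb S^k,\ X\succeq0\}$. Put $E=[I_n\ 0]\in\mathbb R^{n\times p}$, $F_i=[A^i\ -B_2^i]\in\mathbb R^{n\times p}$, $\Phi=\begin{pmatrix}C^\top C&0\\0&D^\top D\end{pmatrix}$, $r=\mathrm{svec}(\Phi)$, $b=\mathrm{svec}(B_1B_1^\top)$, $b_w=[b;\dots;b]$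 ($M$ copies), $A_w^i=T_n(E\otimes F_i+F_i\otimes E)T_p^\top$, $A_w=[A_w^1;\dots;A_w^M]$ (vertical stacking). With $e_k$ the standard basis of $\mathbb R^p$: for $1\le i\le m$, $V_i\in\mathbb R^{D_i\times p}$ has rows $e_k^\top$, $k=D_1+\dots+D_{i-1}+1,\dots,D_1+\dots+D_i$, and $V_{m+i}=e_{n+i}^\top$. Let $N=3m(m-1)/2$ and let $(V_{j1},V_{j2})_{j=1}^N$ enumerate, in lexicographic order of $(i,l)$, the pairs $(V_i,V_l)$ with $1\le i\le m$, $l\in\{i+1,\dots,2m\}\setminus\{i+m\}$, restricted to $l\le 2m-1$ if $i=m$ (automatic, since then $i+m=2m$). Let $v_{j1},v_{j2}$ be the numbers of rows of $V_{j1},V_{j2}$; $B_w^j=(V_{j2}\otimes V_{j1})T_p^\top$, $B_w=[B_w^1;\dots;B_w^N]$. **Spaces and problem.** $\mathcal Z=\mathbb R^{Mn(n+1)/2}$, $\mathcal Y=\mathbb R^{\sum_j v_{j1}v_{j2}}$, $\mathcal V=\mathbb R^{p(p+1)/2}\times\mathcal Z$, $\mathcal U=\mathcal V\times(\mathcal Z\times\mathcal Y)\times\mathcal V$, with Euclidean inner products; $\mathcal I_{\mathcal Z},\mathcal I_{\mathcal Y},\mathcal I_{\mathcal V}$ are identity operators. Variables: $v_\Lambda=[\Lambda;v]\in\mathcal V$, $\xi=[z;y]\in\mathcal Z\times\mathcal Y$, $w_s=[w;s]\in\mathcal V$. Let $\mathcal A=[A_w\ \mathcal I]:\mathcal V\to\mathcal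 Z$, $\mathcal B=[B_w\ 0]:\mathcal V\to\mathcal Y$, and $\tilde{\mathcal A}^*=[\mathcal A^*\ \mathcal B^*]:\mathcal Z\times\mathcal Y\to\mathcal V$ with adjoint $\tilde{\mathcal A}$; $\tilde b=[b_w;0]\in\mathcal Z\times\mathcal Y$, $\tilde r=[r;0]\in\mathcal V$; $\Gamma=\Gamma^{p(p+1)/2}\times\Gamma^{n(n+1)/2}\times\dots\times\Gamma^{n(n+1)/2}$ ($M$ copies of $\Gamma^{n(n+1)/2}$), $\delta_\Gamma$ its indicator function ($0$ on $\Gamma$, $+\infty$ off $\Gamma$). The problem is $$\min_{\xi,v_\Lambda}\ \langle\tilde b,\xi\rangle+\delta_\Gamma(v_\Lambda)\quad\text{s.t.}\quad\tilde{\mathcal A}^*\xi+v_\Lambda=\tilde r,$$ with augmented Lagrangian $$\mathcal L_\sigma(v_\Lambda,\xi;w_s)=\langle\tilde b,\xi\rangle+\delta_\Gamma(v_\Lambda)+\langle w_s,\tilde{\mathcal A}^*\xi+v_\Lambda-\tilde r\rangle+\tfrac\sigma2\|\tilde{\mathcal A}^*\xi+v_\Lambda-\tilde r\|^2 .$$ **Operators.** The (set-valued, maximally monotone) KKT operator on $\mathcal U$ is $$\mathcal T(v_\Lambda,\xi,w_s)=\begin{pmatrix}\partial\delta_\Gamma(v_\Lambda)+w_s\\ \tilde b+\tilde{\mathcal A}w_s\\ \tilde r-\tilde{\mathcal A}^*\xi-v_\Lambda\end{pmatrix}.$$ $\mathcal S_1=\mu_1\mathcal I_{\mathcal V}$.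 $\mathcal S_2:\mathcal Z\times\mathcal Y\to\mathcal Z\times\mathcal Y$ is either (i) $\mathcal S_2=\sigma\mu_0\begin{pmatrix}\mathcal I_{\mathcal Z}&0\\0&\mathcal I_{\mathcal Y}\end{pmatrix}$, or (ii) $\mathcal S_2=\mathcal Q_u\mathcal Q_d^{-1}\mathcal Q_u^*+\sigma\begin{pmatrix}\mu_2\mathcal I_{\mathcal Z}&0\\0&\mu_3\mathcal I_{\mathcal Y}\end{pmatrix}$, where $\mathcal Q_u=\sigma\begin{pmatrix}0&\mathcal A\mathcal B^*\\0&0\end{pmatrix}$, $\mathcal Q_d=\sigma\begin{pmatrix}\mathcal A\mathcal A^*+\mu_2\mathcal I_{\mathcal Z}&0\\0&\mathcal B\mathcal B^*+\mu_3\mathcal I_{\mathcal Y}\end{pmatrix}$. The self-adjoint positive definite operator $\mathcal S:\mathcal U\to\mathcal U$ is $$\mathcal S=\begin{pmatrix}\mathcal S_1&0&0\\0&\sigma\tilde{\mathcal A}\tilde{\mathcal A}^*+\mathcal S_2&\tilde{\mathcal A}\\0&\tilde{\mathcal A}^*&\sigma^{-1}\mathcal I_{\mathcal V}\end{pmatrix}.$$ For a self-adjoint positive semidefinite operator $\mathcal P$, $\|x\|_{\mathcal P}=\sqrt{\langle x,\mathcal Px\rangle}$. $\mathcal T^{-1}(0)=\{u\in\mathcal U:0\in\mathcal T(u)\}$. *)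

theory Defs
  imports
    "HOL-Library.Extended_Real"
    "Jordan_Normal_Form.Gauss_Jordan_Elimination"
    "Jordan_Normal_Form.Char_Poly"
begin

text \<open>
  All dimensions are natural numbers that occur inside the statement, so vectors and matrices are
  those of Jordan_Normal_Form.  The Euclidean spaces are the sets \<open>carrier_vec d\<close>, linear
  operators between them are matrices, the adjoint is the transpose, and an element
  \<open>[x; y]\<close> of a product space is the stacked vector \<open>x @\<^sub>v y\<close>, so that the
  inner product of a product space is again \<open>\<bullet>\<close>.
\<close>

section \<open>Matrix notions missing from the library\<close>

definition append_cols :: "real mat \<Rightarrow> real mat \<Rightarrow> real mat" (infixr \<open>@\<^sub>c\<close> 65) where
  "A @\<^sub>c B = four_block_mat A B (0\<^sub>m 0 (dim_col A)) (0\<^sub>m 0 (dim_col B))"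

text \<open>The column count is a parameter because the list of blocks may be empty.\<close>
definition stack_rows :: "nat \<Rightarrow> real mat list \<Rightarrow> real mat" where
  "stack_rows nc As = foldr append_rows As (0\<^sub>m 0 nc)"

definition stack_vecs :: "real vec list \<Rightarrow> real vec" where
  "stack_vecs vs = foldr append_vec vs (0\<^sub>v 0)"

definition kronecker :: "real mat \<Rightarrow> real mat \<Rightarrow> real mat" (infixl \<open>\<otimes>\<^sub>K\<close> 70) where
  "A \<otimes>\<^sub>K B = mat (dim_row A * dim_row B) (dim_col A * dim_col B)
     (\<lambda>(i, j). A $$ (i div dim_row B, j div dim_col B) * B $$ (i mod dim_row B, j mod dim_col B))"

definition sym_mat :: "nat \<Rightarrow> real mat \<Rightarrow> bool" where
  "sym_mat k S \<longleftrightarrow> S \<in> carrier_mat k k \<and> S\<^sup>T = S"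

definition pos_semidef :: "nat \<Rightarrow> real mat \<Rightarrow> bool" where
  "pos_semidef k S \<longleftrightarrow> sym_mat k S \<and> (\<forall>x \<in> carrier_vec k. 0 \<le> x \<bullet> (S *\<^sub>v x))"

definition pos_def :: "nat \<Rightarrow> real mat \<Rightarrow> bool" where
  "pos_def k S \<longleftrightarrow> sym_mat k S \<and> (\<forall>x \<in> carrier_vec k. x \<noteq> 0\<^sub>v k \<longrightarrow> 0 < x \<bullet> (S *\<^sub>v x))"

definition op_norm :: "real mat \<Rightarrow> real vec \<Rightarrow> real" where
  "op_norm P x = sqrt (x \<bullet> (P *\<^sub>v x))"

text \<open>Continuous-time (Hurwitz) stability.\<close>
definition hurwitz :: "real mat \<Rightarrow> bool" where
  "hurwitz A \<longleftrightarrow> (\<forall>z. eigenvalue (map_mat complex_of_real A) z \<longrightarrow> Re z < 0)"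

definition stabilizable :: "real mat \<Rightarrow> real mat \<Rightarrow> bool" where
  "stabilizable A B \<longleftrightarrow> (\<exists>K \<in> carrier_mat (dim_col B) (dim_row A). hurwitz (A - B * K))"

definition detectable :: "real mat \<Rightarrow> real mat \<Rightarrow> bool" where
  "detectable A C \<longleftrightarrow> (\<exists>L \<in> carrier_mat (dim_row A) (dim_row C). hurwitz (A - L * C))"


section \<open>Vectorisation\<close>

definition tri :: "nat \<Rightarrow> nat" where
  "tri k = k * (k + 1) div 2"

definition vectorize :: "real mat \<Rightarrow> real vec" where
  "vectorize X = vec (dim_row X * dim_col X) (\<lambda>i. X $$ (i mod dim_row X, i div dim_row X))"

text \<open>Positions \<open>(i, j)\<close>, \<open>i \<ge> j\<close>, of the lower triangle, column by column.\<close>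
definition lower_positions :: "nat \<Rightarrow> (nat \<times> nat) list" where
  "lower_positions k = concat (map (\<lambda>j. map (\<lambda>i. (i, j)) [j..<k]) [0..<k])"

definition svec :: "real mat \<Rightarrow> real vec" where
  "svec S = vec_of_list (map (\<lambda>(i, j). if i = j then S $$ (i, j) else sqrt 2 * S $$ (i, j))
     (lower_positions (dim_row S)))"

definition is_svec_mat :: "nat \<Rightarrow> real mat \<Rightarrow> bool" where
  "is_svec_mat k T \<longleftrightarrow> T \<in> carrier_mat (tri k) (k\<^sup>2)
     \<and> (\<forall>S. sym_mat k S \<longrightarrow> svec S = T *\<^sub>v vectorize S)
     \<and> T * T\<^sup>T = 1\<^sub>m (tri k)"

text \<open>These conditions have exactly one solution; see \<open>svec_mat_ex1\<close> below.\<close>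
definition svec_mat :: "nat \<Rightarrow> real mat" where
  "svec_mat k = (THE T. is_svec_mat k T)"

definition psd_cone :: "nat \<Rightarrow> real vec set" where
  "psd_cone k = {svec X |X. pos_semidef k X}"


section \<open>Problem data\<close>

text \<open>
  \<open>blk i\<close>, \<open>vertA i\<close> and \<open>vertB2 i\<close> are \<open>D\<^sub>i\<close>, \<open>A\<^sup>i\<close> and \<open>B\<^sub>2\<^sup>i\<close>;
  their indices start at 1.
\<close>
record problem =
  dn :: nat
  dm :: nat
  dl :: nat
  dq :: nat
  nvert :: nat
  blk :: "nat \<Rightarrow> nat"
  matB1 :: "real mat"
  matC :: "real mat"
  matD :: "real mat"
  matA :: "real mat"
  matB2 :: "real mat"
  vertA :: "nat \<Rightarrow> real mat"
  vertB2 :: "nat \<Rightarrow> real mat"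

definition problem_data :: "problem \<Rightarrow> bool" where
  "problem_data P \<longleftrightarrow>
     dn P \<ge> 1 \<and> dm P \<ge> 1 \<and> nvert P \<ge> 1
     \<and> (\<forall>i \<in> {1..dm P}. blk P i \<ge> 1) \<and> (\<Sum>i = 1..dm P. blk P i) = dn P
     \<and> matB1 P \<in> carrier_mat (dn P) (dl P)
     \<and> matC P \<in> carrier_mat (dq P) (dn P)
     \<and> matD P \<in> carrier_mat (dq P) (dm P)
     \<and> matA P \<in> carrier_mat (dn P) (dn P)
     \<and> matB2 P \<in> carrier_mat (dn P) (dm P)
     \<and> (\<forall>i \<in> {1..nvert P}. vertA P i \<in> carrier_mat (dn P) (dn P)
          \<and> vertB2 P i \<in> carrier_mat (dn P) (dm P))"

definition standing_assumption :: "problem \<Rightarrow> bool" where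
  "standing_assumption P \<longleftrightarrow>
     (matC P)\<^sup>T * matD P = 0\<^sub>m (dn P) (dm P)
     \<and> pos_def (dm P) ((matD P)\<^sup>T * matD P)
     \<and> stabilizable (matA P) (matB2 P)
     \<and> detectable (matA P) (matC P)"

definition dp :: "problem \<Rightarrow> nat" where
  "dp P = dn P + dm P"

definition matE :: "problem \<Rightarrow> real mat" where
  "matE P = 1\<^sub>m (dn P) @\<^sub>c 0\<^sub>m (dn P) (dm P)"

definition matF :: "problem \<Rightarrow> nat \<Rightarrow> real mat" where
  "matF P i = vertA P i @\<^sub>c (- vertB2 P i)"

definition matPhi :: "problem \<Rightarrow> real mat" where
  "matPhi P = four_block_mat ((matC P)\<^sup>T * matC P) (0\<^sub>m (dn P) (dm P))
     (0\<^sub>m (dm P) (dn P)) ((matD P)\<^sup>T * matD P)"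

definition vec_r :: "problem \<Rightarrow> real vec" where
  "vec_r P = svec (matPhi P)"

definition vec_b :: "problem \<Rightarrow> real vec" where
  "vec_b P = svec (matB1 P * (matB1 P)\<^sup>T)"

definition vec_bw :: "problem \<Rightarrow> real vec" where
  "vec_bw P = stack_vecs (replicate (nvert P) (vec_b P))"

definition Aw_block :: "problem \<Rightarrow> nat \<Rightarrow> real mat" where
  "Aw_block P i = svec_mat (dn P) * (matE P \<otimes>\<^sub>K matF P i + matF P i \<otimes>\<^sub>K matE P)
     * (svec_mat (dp P))\<^sup>T"

definition Aw :: "problem \<Rightarrow> real mat" where
  "Aw P = stack_rows (tri (dp P)) (map (Aw_block P) [1..<nvert P + 1])"

text \<open>
  With the 1-based basis vector \<open>e\<^sub>k\<close> being \<open>unit_vec p (k - 1)\<close>; \<open>i\<close> ranges over \<open>1..2m\<close>.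
\<close>
definition matV :: "problem \<Rightarrow> nat \<Rightarrow> real mat" where
  "matV P i =
     (if i \<le> dm P
      then let s = (\<Sum>t = 1..<i. blk P t) in
        mat_of_rows (dp P) (map (\<lambda>k. unit_vec (dp P) (k - 1)) [s + 1..<s + blk P i + 1])
      else mat_of_rows (dp P) [unit_vec (dp P) (dn P + (i - dm P) - 1)])"

text \<open>For \<open>i = m\<close> the bound \<open>l \<le> 2m - 1\<close> is implied by \<open>l \<noteq> i + m\<close>.\<close>
definition index_pairs :: "nat \<Rightarrow> (nat \<times> nat) list" where
  "index_pairs m = [(i, l). i \<leftarrow> [1..<m + 1], l \<leftarrow> [i + 1..<2 * m + 1], l \<noteq> i + m]"

definition Bw_block :: "problem \<Rightarrow> nat \<times> nat \<Rightarrow> real mat" where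
  "Bw_block P = (\<lambda>(i, l). (matV P l \<otimes>\<^sub>K matV P i) * (svec_mat (dp P))\<^sup>T)"

definition Bw :: "problem \<Rightarrow> real mat" where
  "Bw P = stack_rows (tri (dp P)) (map (Bw_block P) (index_pairs (dm P)))"


section \<open>Spaces and the optimisation problem\<close>

definition dZ :: "problem \<Rightarrow> nat" where
  "dZ P = nvert P * tri (dn P)"

definition dY :: "problem \<Rightarrow> nat" where
  "dY P = (\<Sum>(i, l) \<leftarrow> index_pairs (dm P). dim_row (matV P i) * dim_row (matV P l))"

definition dV :: "problem \<Rightarrow> nat" where
  "dV P = tri (dp P) + dZ P"

definition spaceV :: "problem \<Rightarrow> real vec set" where
  "spaceV P = carrier_vec (dV P)"

definition spaceZY :: "problem \<Rightarrow> real vec set" where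
  "spaceZY P = carrier_vec (dZ P + dY P)"

definition spaceU :: "problem \<Rightarrow> real vec set" where
  "spaceU P = carrier_vec (dV P + ((dZ P + dY P) + dV P))"

definition opA :: "problem \<Rightarrow> real mat" where
  "opA P = Aw P @\<^sub>c 1\<^sub>m (dZ P)"

definition opB :: "problem \<Rightarrow> real mat" where
  "opB P = Bw P @\<^sub>c 0\<^sub>m (dY P) (dZ P)"

definition Atilde_adj :: "problem \<Rightarrow> real mat" where
  "Atilde_adj P = (opA P)\<^sup>T @\<^sub>c (opB P)\<^sup>T"

definition Atilde :: "problem \<Rightarrow> real mat" where
  "Atilde P = (Atilde_adj P)\<^sup>T"

definition btilde :: "problem \<Rightarrow> real vec" where
  "btilde P = vec_bw P @\<^sub>v 0\<^sub>v (dY P)"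

definition rtilde :: "problem \<Rightarrow> real vec" where
  "rtilde P = vec_r P @\<^sub>v 0\<^sub>v (dZ P)"

definition Gam :: "problem \<Rightarrow> real vec set" where
  "Gam P = {g @\<^sub>v stack_vecs gs |g gs. g \<in> psd_cone (dp P) \<and>
     length gs = nvert P \<and> set gs \<subseteq> psd_cone (dn P)}"

definition indicator_fun :: "real vec set \<Rightarrow> real vec \<Rightarrow> ereal" where
  "indicator_fun G x = (if x \<in> G then 0 else \<infinity>)"

definition subdifferential :: "nat \<Rightarrow> (real vec \<Rightarrow> ereal) \<Rightarrow> real vec \<Rightarrow> real vec set" where
  "subdifferential d f x =
     {g \<in> carrier_vec d. \<forall>y \<in> carrier_vec d. f y \<ge> f x + ereal (g \<bullet> (y - x))}"

definition residual :: "problem \<Rightarrow> real vec \<Rightarrow> real vec \<Rightarrow> real vec" where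
  "residual P vL xi = Atilde_adj P *\<^sub>v xi + vL - rtilde P"

definition aug_lagrangian ::
  "problem \<Rightarrow> real \<Rightarrow> real vec \<Rightarrow> real vec \<Rightarrow> real vec \<Rightarrow> ereal" where
  "aug_lagrangian P \<sigma> vL xi ws =
     ereal (btilde P \<bullet> xi) + indicator_fun (Gam P) vL
     + ereal (ws \<bullet> residual P vL xi)
     + ereal (\<sigma> / 2 * (residual P vL xi \<bullet> residual P vL xi))"


section \<open>Operators\<close>

definition opT :: "problem \<Rightarrow> real vec \<Rightarrow> real vec set" where
  "opT P u = {(g + ws) @\<^sub>v (btilde P + Atilde P *\<^sub>v ws)
                @\<^sub>v (rtilde P - Atilde_adj P *\<^sub>v xi - vL) |vL xi ws g.
     vL \<in> spaceV P \<and> xi \<in> spaceZY P \<and> ws \<in> spaceV P \<and> u = vL @\<^sub>v xi @\<^sub>v ws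
     \<and> g \<in> subdifferential (dV P) (indicator_fun (Gam P)) vL}"

definition zeros_T :: "problem \<Rightarrow> real vec set" where
  "zeros_T P = {u \<in> spaceU P. 0\<^sub>v (dV P + ((dZ P + dY P) + dV P)) \<in> opT P u}"

definition opS1 :: "problem \<Rightarrow> real \<Rightarrow> real mat" where
  "opS1 P \<mu>1 = \<mu>1 \<cdot>\<^sub>m 1\<^sub>m (dV P)"

definition diag_ZY :: "problem \<Rightarrow> real mat \<Rightarrow> real mat \<Rightarrow> real mat" where
  "diag_ZY P X Y = four_block_mat X (0\<^sub>m (dZ P) (dY P)) (0\<^sub>m (dY P) (dZ P)) Y"

definition opS2_i :: "problem \<Rightarrow> real \<Rightarrow> real \<Rightarrow> real mat" where
  "opS2_i P \<sigma> \<mu>0 = (\<sigma> * \<mu>0) \<cdot>\<^sub>m diag_ZY P (1\<^sub>m (dZ P)) (1\<^sub>m (dY P))"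

definition opQu :: "problem \<Rightarrow> real \<Rightarrow> real mat" where
  "opQu P \<sigma> = \<sigma> \<cdot>\<^sub>m four_block_mat (0\<^sub>m (dZ P) (dZ P)) (opA P * (opB P)\<^sup>T)
     (0\<^sub>m (dY P) (dZ P)) (0\<^sub>m (dY P) (dY P))"

definition opQd :: "problem \<Rightarrow> real \<Rightarrow> real \<Rightarrow> real \<Rightarrow> real mat" where
  "opQd P \<sigma> \<mu>2 \<mu>3 = \<sigma> \<cdot>\<^sub>m diag_ZY P
     (opA P * (opA P)\<^sup>T + \<mu>2 \<cdot>\<^sub>m 1\<^sub>m (dZ P))
     (opB P * (opB P)\<^sup>T + \<mu>3 \<cdot>\<^sub>m 1\<^sub>m (dY P))"

definition opS2_ii :: "problem \<Rightarrow> real \<Rightarrow> real \<Rightarrow> real \<Rightarrow> real mat" where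
  "opS2_ii P \<sigma> \<mu>2 \<mu>3 =
     opQu P \<sigma> * the (mat_inverse (opQd P \<sigma> \<mu>2 \<mu>3)) * (opQu P \<sigma>)\<^sup>T
     + \<sigma> \<cdot>\<^sub>m diag_ZY P (\<mu>2 \<cdot>\<^sub>m 1\<^sub>m (dZ P)) (\<mu>3 \<cdot>\<^sub>m 1\<^sub>m (dY P))"

definition opS :: "problem \<Rightarrow> real \<Rightarrow> real \<Rightarrow> real mat \<Rightarrow> real mat" where
  "opS P \<sigma> \<mu>1 S2 = four_block_mat
     (opS1 P \<mu>1) (0\<^sub>m (dV P) ((dZ P + dY P) + dV P))
     (0\<^sub>m ((dZ P + dY P) + dV P) (dV P))
     (four_block_mat (\<sigma> \<cdot>\<^sub>m (Atilde P * Atilde_adj P) + S2) (Atilde P)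
        (Atilde_adj P) (inverse \<sigma> \<cdot>\<^sub>m 1\<^sub>m (dV P)))"

definition resolvent :: "problem \<Rightarrow> real mat \<Rightarrow> real vec \<Rightarrow> real vec" where
  "resolvent P S y = (THE w. w \<in> spaceU P \<and> (\<exists>t \<in> opT P w. y = S *\<^sub>v w + t))"

text \<open>The fixed-point map \<open>F\<close>; its argument \<open>S\<close> is instantiated with \<open>opS P \<sigma> \<mu>1 S2\<close>.\<close>
definition fixpoint_map :: "problem \<Rightarrow> real mat \<Rightarrow> real \<Rightarrow> real vec \<Rightarrow> real vec" where
  "fixpoint_map P S \<rho> u = (1 - \<rho>) \<cdot>\<^sub>v u + \<rho> \<cdot>\<^sub>v resolvent P S (S *\<^sub>v u)"


section \<open>Existence and uniqueness of the matrix representing svec\<close>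

lemma lower_positions_set: "set (lower_positions k) = {(i, j). j \<le> i \<and> i < k}"
  by (force simp: lower_positions_def)

lemma lower_positions_distinct: "distinct (lower_positions k)"
  unfolding lower_positions_def
proof (rule distinct_concat)
  show "distinct (map (\<lambda>j. map (\<lambda>i. (i, j)) [j..<k]) [0..<k])"
  proof (auto simp: distinct_map inj_on_def)
    fix x y assume "x < k" "y < k" "map (\<lambda>i. (i, x)) [x..<k] = map (\<lambda>i. (i, y)) [y..<k]"
    then show "x = y"
      using map_eq_imp_length_eq[of "\<lambda>i. (i, x)" "[x..<k]" "\<lambda>i. (i, y)" "[y..<k]"] by simp
  qed
qed (auto simp: distinct_map inj_on_def)

lemma lower_positions_length: "length (lower_positions k) = tri k"
proof -
  have "length (lower_positions k) = (\<Sum>j<k. k - j)"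
    by (simp add: lower_positions_def length_concat comp_def interv_sum_list_conv_sum_set_nat
        atLeast0LessThan)
  also have "\<dots> = (\<Sum>j<k. Suc j)"
    by (subst sum.nat_diff_reindex[symmetric]) (auto intro!: sum.cong)
  also have "2 * \<dots> = k * (k + 1)"
    by (induction k) auto
  then have "(\<Sum>j<k. Suc j) = tri k" by (simp add: tri_def)
  finally show ?thesis .
qed

lemma dim_svec: "dim_vec (svec S) = tri (dim_row S)"
  by (simp add: svec_def lower_positions_length)

definition svec_entry :: "nat \<times> nat \<Rightarrow> nat \<Rightarrow> nat \<Rightarrow> real" where
  "svec_entry = (\<lambda>(i, j) a b. if i = j then (if a = i \<and> b = i then 1 else 0)
     else (if a = i \<and> b = j then 1 / sqrt 2 else 0) + (if a = j \<and> b = i then 1 / sqrt 2 else 0))"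

definition svec_mat0 :: "nat \<Rightarrow> real mat" where
  "svec_mat0 k = mat (tri k) (k\<^sup>2) (\<lambda>(r, c). svec_entry (lower_positions k ! r) (c mod k) (c div k))"

lemma sum_square_index:
  fixes g :: "nat \<Rightarrow> nat \<Rightarrow> real"
  shows "(\<Sum>c = 0..<k\<^sup>2. g (c mod k) (c div k)) = (\<Sum>b<k. \<Sum>a<k. g a b)"
proof -
  have "(\<Sum>c = 0..<k\<^sup>2. g (c mod k) (c div k)) = (\<Sum>c<k*k. g (c mod k) (c div k))"
    by (simp add: power2_eq_square atLeast0LessThan)
  also have "\<dots> = (\<Sum>b<k. \<Sum>c = b*k..<b*k+k. g (c mod k) (c div k))"
    by (rule sum.nat_group[symmetric])
  also have "\<dots> = (\<Sum>b<k. \<Sum>a<k. g a b)"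
  proof (rule sum.cong[OF refl])
    fix b assume "b \<in> {..<k}"
    have "(\<Sum>c = b*k..<b*k+k. g (c mod k) (c div k)) = (\<Sum>a<k. g ((a + b*k) mod k) ((a + b*k) div k))"
      using sum.shift_bounds_nat_ivl[of "\<lambda>c. g (c mod k) (c div k)" 0 "b*k" k]
      by (simp add: atLeast0LessThan add.commute)
    also have "\<dots> = (\<Sum>a<k. g a b)" by (rule sum.cong) auto
    finally show "(\<Sum>c = b*k..<b*k+k. g (c mod k) (c div k)) = (\<Sum>a<k. g a b)" .
  qed
  finally show ?thesis .
qed

lemma sum_pick:
  fixes X :: "nat \<Rightarrow> nat \<Rightarrow> real"
  assumes "i < k" "j < k"
  shows "(\<Sum>b<k. \<Sum>a<k. (if a = i \<and> b = j then x else 0) * X a b) = x * X i j"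
proof -
  have "(\<Sum>b<k. \<Sum>a<k. (if a = i \<and> b = j then x else 0) * X a b)
      = (\<Sum>b<k. if b = j then x * X i b else 0)"
  proof (rule sum.cong[OF refl])
    fix b
    have "(\<Sum>a<k. (if a = i \<and> b = j then x else 0) * X a b)
        = (\<Sum>a<k. if a = i then (if b = j then x * X a b else 0) else 0)"
      by (rule sum.cong) auto
    also have "\<dots> = (if b = j then x * X i b else 0)"
      using assms by (simp add: sum.delta)
    finally show "(\<Sum>a<k. (if a = i \<and> b = j then x else 0) * X a b) = (if b = j then x * X i b else 0)" .
  qed
  also have "\<dots> = x * X i j" using assms by (simp add: sum.delta)
  finally show ?thesis .
qed

lemma svec_entry_sum:
  fixes X :: "nat \<Rightarrow> nat \<Rightarrow> real"
  assumes "i < k" "j < k"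
  shows "(\<Sum>b<k. \<Sum>a<k. svec_entry (i, j) a b * X a b)
    = (if i = j then X i i else (X i j + X j i) / sqrt 2)"
proof (cases "i = j")
  case True
  then show ?thesis using sum_pick[OF assms, of 1 X] assms by (simp add: svec_entry_def)
next
  case False
  have "(\<Sum>b<k. \<Sum>a<k. svec_entry (i, j) a b * X a b)
     = (\<Sum>b<k. \<Sum>a<k. (if a = i \<and> b = j then 1 / sqrt 2 else 0) * X a b)
      + (\<Sum>b<k. \<Sum>a<k. (if a = j \<and> b = i then 1 / sqrt 2 else 0) * X a b)"
    using False unfolding svec_entry_def sum.distrib[symmetric] by (simp add: distrib_right)
  then show ?thesis using False
    by (simp only: sum_pick[OF assms] sum_pick[OF assms(2,1)]) (simp add: add_divide_distrib)
qed

lemma svec_entry_sym: "svec_entry q a b = svec_entry q b a"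
  by (cases q) (simp add: svec_entry_def conj_commute add.commute)

lemma mat_mult_vectorize:
  assumes T: "T \<in> carrier_mat d (k\<^sup>2)" and S: "S \<in> carrier_mat k k" and r: "r < d"
  shows "(T *\<^sub>v vectorize S) $ r = (\<Sum>b<k. \<Sum>a<k. T $$ (r, a + b * k) * S $$ (a, b))"
proof -
  have "(T *\<^sub>v vectorize S) $ r = (\<Sum>c = 0..<k\<^sup>2. T $$ (r, c) * S $$ (c mod k, c div k))"
    using assms by (auto simp: scalar_prod_def vectorize_def power2_eq_square intro!: sum.cong)
  also have "\<dots> = (\<Sum>c = 0..<k\<^sup>2. (\<lambda>a b. T $$ (r, a + b * k) * S $$ (a, b)) (c mod k) (c div k))"
    by (simp add: mod_mult_div_eq mult.commute)
  also have "\<dots> = (\<Sum>b<k. \<Sum>a<k. T $$ (r, a + b * k) * S $$ (a, b))"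
    by (rule sum_square_index)
  finally show ?thesis .
qed

lemma mat_self_prod:
  fixes T :: "real mat"
  assumes T: "T \<in> carrier_mat d (k\<^sup>2)" and r: "r < d" "s < d"
  shows "(T * T\<^sup>T) $$ (r, s) = (\<Sum>b<k. \<Sum>a<k. T $$ (r, a + b * k) * T $$ (s, a + b * k))"
proof -
  have "(T * T\<^sup>T) $$ (r, s) = (\<Sum>c = 0..<k\<^sup>2. T $$ (r, c) * T $$ (s, c))"
    using assms by (auto simp: scalar_prod_def intro!: sum.cong)
  also have "\<dots> = (\<Sum>c = 0..<k\<^sup>2. (\<lambda>a b. T $$ (r, a + b * k) * T $$ (s, a + b * k)) (c mod k) (c div k))"
    by (simp add: mod_mult_div_eq mult.commute)
  also have "\<dots> = (\<Sum>b<k. \<Sum>a<k. T $$ (r, a + b * k) * T $$ (s, a + b * k))"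
    using sum_square_index[of "\<lambda>a b. T $$ (r, a + b * k) * T $$ (s, a + b * k)" k] by simp
  finally show ?thesis .
qed

lemma index_bound: "a < k \<Longrightarrow> b < k \<Longrightarrow> a + b * k < (k::nat)\<^sup>2"
proof -
  assume "a < k" "b < k"
  then have "a + b * k < k + b * k" by simp
  also have "\<dots> = (b + 1) * k" by simp
  also have "\<dots> \<le> k * k" using \<open>b < k\<close> by (intro mult_right_mono) auto
  finally show ?thesis by (simp add: power2_eq_square)
qed

lemma svec_mat0_index:
  "r < tri k \<Longrightarrow> a < k \<Longrightarrow> b < k \<Longrightarrow>
    svec_mat0 k $$ (r, a + b * k) = svec_entry (lower_positions k ! r) a b"
  by (simp add: svec_mat0_def index_bound)

lemma lower_position_bounds:
  assumes "r < tri k"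
  obtains i j where "lower_positions k ! r = (i, j)" "j \<le> i" "i < k"
proof -
  have "lower_positions k ! r \<in> set (lower_positions k)"
    using assms by (intro nth_mem) (simp add: lower_positions_length)
  then show ?thesis
    using that unfolding lower_positions_set by blast
qed

lemma is_svec_mat_svec_mat0: "is_svec_mat k (svec_mat0 k)"
  unfolding is_svec_mat_def
proof (intro conjI allI impI)
  show car: "svec_mat0 k \<in> carrier_mat (tri k) (k\<^sup>2)" by (simp add: svec_mat0_def)
  show "svec S = svec_mat0 k *\<^sub>v vectorize S" if S: "sym_mat k S" for S
  proof (rule eq_vecI)
    have Sc: "S \<in> carrier_mat k k" and ST: "S\<^sup>T = S" using S by (auto simp: sym_mat_def)
    show "dim_vec (svec S) = dim_vec (svec_mat0 k *\<^sub>v vectorize S)"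
      using Sc car by (simp add: dim_svec)
    fix r assume "r < dim_vec (svec_mat0 k *\<^sub>v vectorize S)"
    then have r: "r < tri k" using car by simp
    then obtain i j where ij: "lower_positions k ! r = (i, j)" "j \<le> i" "i < k"
      by (rule lower_position_bounds)
    have symS: "S $$ (j, i) = S $$ (i, j)"
      using arg_cong[OF ST, of "\<lambda>X. X $$ (i, j)"] Sc ij by auto
    have "(svec_mat0 k *\<^sub>v vectorize S) $ r
      = (\<Sum>b<k. \<Sum>a<k. svec_entry (i, j) a b * S $$ (a, b))"
      unfolding mat_mult_vectorize[OF car Sc r]
      using r ij by (intro sum.cong refl) (simp add: svec_mat0_index)
    also have "\<dots> = (if i = j then S $$ (i, i) else (S $$ (i, j) + S $$ (j, i)) / sqrt 2)"
      using ij by (intro svec_entry_sum) auto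
    also have "\<dots> = (if i = j then S $$ (i, i) else sqrt 2 * S $$ (i, j))"
      unfolding symS by (auto simp: field_simps)
    also have "\<dots> = svec S $ r"
      using Sc r ij by (simp add: svec_def lower_positions_length vec_of_list_index)
    finally show "svec S $ r = (svec_mat0 k *\<^sub>v vectorize S) $ r" by simp
  qed
  show "svec_mat0 k * (svec_mat0 k)\<^sup>T = 1\<^sub>m (tri k)"
  proof (rule eq_matI)
    fix r s assume "r < dim_row (1\<^sub>m (tri k) :: real mat)" "s < dim_col (1\<^sub>m (tri k) :: real mat)"
    then have rs: "r < tri k" "s < tri k" by auto
    obtain i j where ij: "lower_positions k ! r = (i, j)" "j \<le> i" "i < k"
      using rs(1) by (rule lower_position_bounds)
    obtain i' j' where ij': "lower_positions k ! s = (i', j')" "j' \<le> i'" "i' < k"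
      using rs(2) by (rule lower_position_bounds)
    have eq: "r = s \<longleftrightarrow> i = i' \<and> j = j'"
      using nth_eq_iff_index_eq[OF lower_positions_distinct, of r k s] rs ij(1) ij'(1)
      by (auto simp: lower_positions_length)
    have "(svec_mat0 k * (svec_mat0 k)\<^sup>T) $$ (r, s)
      = (\<Sum>b<k. \<Sum>a<k. svec_entry (i, j) a b * svec_entry (i', j') a b)"
      unfolding mat_self_prod[OF car rs]
      using rs ij ij' by (intro sum.cong refl) (simp add: svec_mat0_index)
    also have "\<dots> = (if i = j then svec_entry (i', j') i i
        else (svec_entry (i', j') i j + svec_entry (i', j') j i) / sqrt 2)"
      using ij by (intro svec_entry_sum) auto
    also have "\<dots> = (if r = s then 1 else 0)"
    proof (cases "i = j")
      case True
      then show ?thesis using ij' unfolding eq by (auto simp: svec_entry_def)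
    next
      case False
      have "\<not> (i = j' \<and> j = i')" "\<not> (j = j' \<and> i = i' \<and> i' = j')" "\<not> (i = i' \<and> j = i')"
        using False ij(2) ij'(2) by linarith+
      then show ?thesis using False unfolding eq svec_entry_def
        by (simp add: conj_commute)
    qed
    finally show "(svec_mat0 k * (svec_mat0 k)\<^sup>T) $$ (r, s) = 1\<^sub>m (tri k) $$ (r, s)"
      using rs by simp
  qed (use car in auto)
qed

lemma is_svec_mat_unique:
  assumes T: "is_svec_mat k T"
  shows "T = svec_mat0 k"
proof -
  let ?U = "svec_mat0 k"
  have Tc: "T \<in> carrier_mat (tri k) (k\<^sup>2)" and TT: "T * T\<^sup>T = 1\<^sub>m (tri k)"
    and Ts: "\<And>S. sym_mat k S \<Longrightarrow> svec S = T *\<^sub>v vectorize S"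
    using T unfolding is_svec_mat_def by blast+
  have Uc: "?U \<in> carrier_mat (tri k) (k\<^sup>2)" and UU: "?U * ?U\<^sup>T = 1\<^sub>m (tri k)"
    and Us: "\<And>S. sym_mat k S \<Longrightarrow> svec S = ?U *\<^sub>v vectorize S"
    using is_svec_mat_svec_mat0[of k] unfolding is_svec_mat_def by blast+
  have row_eq: "T $$ (r, a + b * k) = ?U $$ (r, a + b * k)"
    if r: "r < tri k" and ab: "a < k" "b < k" for r a b
  proof -
    define t where "t = (\<lambda>a b. T $$ (r, a + b * k))"
    define u where "u = (\<lambda>a b. ?U $$ (r, a + b * k))"
    define N where "N = (\<lambda>a b. t a b - u a b)"
    have anti: "N x y = - N y x" if xy: "x < k" "y < k" for x y
    proof -
      define S :: "real mat" where "S = mat k k (\<lambda>(a, b).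
        (if a = x \<and> b = y then 1 else 0) + (if a = y \<and> b = x then 1 else 0))"
      have S: "sym_mat k S"
        unfolding sym_mat_def S_def by (auto intro!: eq_matI simp only:
          dim_row_mat dim_col_mat index_mat index_transpose_mat transpose_carrier_mat mat_carrier
          case_prod_conv conj_commute add.commute)
      then have Sc: "S \<in> carrier_mat k k" by (simp add: sym_mat_def)
      have val: "(\<Sum>b<k. \<Sum>a<k. f a b * S $$ (a, b)) = f x y + f y x" for f :: "nat \<Rightarrow> nat \<Rightarrow> real"
      proof -
        have "(\<Sum>b<k. \<Sum>a<k. f a b * S $$ (a, b))
          = (\<Sum>b<k. \<Sum>a<k. (if a = x \<and> b = y then 1 else 0) * f a b)
          + (\<Sum>b<k. \<Sum>a<k. (if a = y \<and> b = x then 1 else 0) * f a b)"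
          unfolding sum.distrib[symmetric] by (intro sum.cong refl) (simp add: S_def distrib_left)
        then show ?thesis
          by (simp only: sum_pick[OF xy] sum_pick[OF xy(2,1)] mult_1)
      qed
      have "(T *\<^sub>v vectorize S) $ r = (?U *\<^sub>v vectorize S) $ r"
        using Ts[OF S] Us[OF S] by simp
      then have "t x y + t y x = u x y + u y x"
        unfolding mat_mult_vectorize[OF Tc Sc r] mat_mult_vectorize[OF Uc Sc r] val
        by (simp add: t_def u_def)
      then show ?thesis by (simp add: N_def)
    qed
    have usym: "u x y = u y x" if "x < k" "y < k" for x y
      using that r by (simp add: u_def svec_mat0_index svec_entry_sym)
    let ?c = "\<Sum>b<k. \<Sum>a<k. u a b * N a b"
    have "?c = (\<Sum>b<k. \<Sum>a<k. u b a * N b a)" by (rule sum.swap)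
    also have "\<dots> = (\<Sum>b<k. \<Sum>a<k. - (u a b * N a b))"
    proof (intro sum.cong refl)
      fix b a assume "b \<in> {..<k}" "a \<in> {..<k}"
      then show "u b a * N b a = - (u a b * N a b)"
        using usym[of b a] anti[of b a] by simp
    qed
    also have "\<dots> = - ?c" by (simp add: sum_negf)
    finally have c0: "?c = 0" by simp
    have t1: "(\<Sum>b<k. \<Sum>a<k. t a b * t a b) = 1"
      using mat_self_prod[OF Tc r r] TT r by (simp add: t_def)
    have u1: "(\<Sum>b<k. \<Sum>a<k. u a b * u a b) = 1"
      using mat_self_prod[OF Uc r r] UU r by (simp add: u_def)
    have "(\<Sum>b<k. \<Sum>a<k. t a b * t a b) = (\<Sum>b<k. \<Sum>a<k. u a b * u a b) + 2 * ?c
        + (\<Sum>b<k. \<Sum>a<k. N a b * N a b)"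
      unfolding sum_distrib_left sum.distrib[symmetric]
      by (intro sum.cong refl) (simp add: N_def algebra_simps)
    then have "(\<Sum>b<k. \<Sum>a<k. N a b * N a b) = 0" using t1 u1 c0 by simp
    then have "\<forall>b\<in>{..<k}. (\<Sum>a<k. N a b * N a b) = 0"
      by (subst (asm) sum_nonneg_eq_0_iff) (auto intro: sum_nonneg)
    then have "(\<Sum>a<k. N a b * N a b) = 0" using ab by simp
    then have "\<forall>a\<in>{..<k}. N a b * N a b = 0"
      by (subst (asm) sum_nonneg_eq_0_iff) auto
    then show ?thesis using ab by (simp add: N_def t_def u_def)
  qed
  show ?thesis
  proof (rule eq_matI)
    fix r c assume "r < dim_row ?U" "c < dim_col ?U"
    then have r: "r < tri k" and c: "c < k\<^sup>2" using Uc by auto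
    have "c < k * k" using c by (simp add: power2_eq_square)
    then have "0 < k" by (cases k) auto
    then have "c mod k < k" "c div k < k"
      using \<open>c < k * k\<close> by (auto simp: less_mult_imp_div_less)
    then show "T $$ (r, c) = ?U $$ (r, c)"
      using row_eq[OF r, of "c mod k" "c div k"] by simp
  qed (use Tc Uc in auto)
qed

lemma svec_mat_ex1: "\<exists>!T. is_svec_mat k T"
  using is_svec_mat_svec_mat0 is_svec_mat_unique by blast

lemma is_svec_mat_svec_mat: "is_svec_mat k (svec_mat k)"
  unfolding svec_mat_def using svec_mat_ex1 by (rule theI')

end

theory Submission
  imports Defs
begin

text \<open>
  The optimality conditions of the two subproblems say exactly that
  \<open>S (u\<^sup>k - u_bar\<^sup>k) \<in> T u_bar\<^sup>k\<close>: one sweep of the proximal ADMM evaluates the resolvent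
  \<open>(S + T)\<^sup>-\<^sup>1 S\<close>, which is single-valued since \<open>S\<close> is positive definite and \<open>T\<close> monotone.
  Monotonicity makes this resolvent firmly nonexpansive in the \<open>S\<close>-norm, so \<open>F\<close> is nonexpansive
  for \<open>\<rho> \<le> 2\<close>, and the accelerated scheme is the Halpern iteration of \<open>F\<close>.  For
  \<open>r\<^sub>k = u\<^sup>k - F u\<^sup>k\<close> the inequality
  \<open>k / 2 \<cdot> \<parallel>r\<^sub>k\<parallel>\<^sup>2 \<le> \<langle>r\<^sub>k, u\<^sup>0 - u\<^sup>k\<rangle>\<close> propagates along the iteration (Lieder);
  adding \<open>\<parallel>r\<^sub>k\<parallel>\<^sup>2 / 2 \<le> \<langle>r\<^sub>k, u\<^sup>k - u\<^sup>*\<rangle>\<close> gives the rate.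
\<close>

section \<open>Halpern iteration in a seminorm\<close>

text \<open>The estimates below rest on symmetry and nonnegativity of the form \<open>ip\<close>,
  which may be degenerate. It is interpreted twice: with \<open>S2\<close> for the \<xi>-subproblem
  and with \<open>opS\<close> on the whole space.\<close>

locale psd_form =
  fixes d :: nat and S :: "real mat"
  assumes psd: "pos_semidef d S"
begin

definition ip :: "real vec \<Rightarrow> real vec \<Rightarrow> real" where
  "ip x y = x \<bullet> (S *\<^sub>v y)"

lemma S_carrier [simp]: "S \<in> carrier_mat d d"
  using psd by (simp add: pos_semidef_def sym_mat_def)

lemma ip_add_left: "x \<in> carrier_vec d \<Longrightarrow> y \<in> carrier_vec d \<Longrightarrow> z \<in> carrier_vec d \<Longrightarrow>
    ip (x + y) z = ip x z + ip y z"
  unfolding ip_def by (rule add_scalar_prod_distrib[where n = d]) (auto intro!: mult_mat_vec_carrier[OF S_carrier])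

lemma ip_diff_left: "x \<in> carrier_vec d \<Longrightarrow> y \<in> carrier_vec d \<Longrightarrow> z \<in> carrier_vec d \<Longrightarrow>
    ip (x - y) z = ip x z - ip y z"
  unfolding ip_def by (rule minus_scalar_prod_distrib[where n = d]) (auto intro!: mult_mat_vec_carrier[OF S_carrier])

lemma ip_smult_left: "x \<in> carrier_vec d \<Longrightarrow> z \<in> carrier_vec d \<Longrightarrow> ip (a \<cdot>\<^sub>v x) z = a * ip x z"
  unfolding ip_def by (rule smult_scalar_prod_distrib[where n = d]) (auto intro!: mult_mat_vec_carrier[OF S_carrier])

lemma ip_commute: "x \<in> carrier_vec d \<Longrightarrow> y \<in> carrier_vec d \<Longrightarrow> ip x y = ip y x"
proof -
  assume xy: "x \<in> carrier_vec d" "y \<in> carrier_vec d"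
  have "ip x y = (S\<^sup>T *\<^sub>v x) \<bullet> y"
    unfolding ip_def using xy by (intro transpose_vec_mult_scalar[symmetric]) auto
  also have "\<dots> = ip y x"
    unfolding ip_def using xy psd
    by (subst comm_scalar_prod[where n = d])
      (auto simp: pos_semidef_def sym_mat_def intro!: mult_mat_vec_carrier[OF S_carrier])
  finally show ?thesis .
qed

lemma ip_add_right: "x \<in> carrier_vec d \<Longrightarrow> y \<in> carrier_vec d \<Longrightarrow> z \<in> carrier_vec d \<Longrightarrow>
    ip z (x + y) = ip z x + ip z y"
  by (simp add: ip_commute[of z] ip_add_left)

lemma ip_diff_right: "x \<in> carrier_vec d \<Longrightarrow> y \<in> carrier_vec d \<Longrightarrow> z \<in> carrier_vec d \<Longrightarrow>
    ip z (x - y) = ip z x - ip z y"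
  by (simp add: ip_commute[of z] ip_diff_left)

lemma ip_smult_right: "x \<in> carrier_vec d \<Longrightarrow> z \<in> carrier_vec d \<Longrightarrow> ip z (a \<cdot>\<^sub>v x) = a * ip z x"
  by (simp add: ip_commute[of z] ip_smult_left)

lemmas ip_simps = ip_add_left ip_diff_left ip_smult_left ip_add_right ip_diff_right ip_smult_right

lemma ip_nonneg: "x \<in> carrier_vec d \<Longrightarrow> 0 \<le> ip x x"
  using psd by (simp add: pos_semidef_def ip_def)

text \<open>\<open>firm\<close> is monotonicity of T tested at the resolvent values
  \<open>z\<close>, \<open>z'\<close> of \<open>x\<close>, \<open>x'\<close>. With a = x - x' and c
  = z - z' the relaxed points differ by a - \<rho>(a - c). Since <a, a - c> = <c, a - c> + |a -
  c|^2, the square is |a|^2 diminished by 2\<rho> <c, a - c> and by \<rho>(2 - \<rho>)|a - c|^2,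
  both nonnegative. Working with points instead of a map covers consecutive iterates as well as an
  iterate paired with a zero of T.\<close>

lemma relaxation_nonexpansive:
  assumes carr: "x \<in> carrier_vec d" "x' \<in> carrier_vec d" "z \<in> carrier_vec d" "z' \<in> carrier_vec d"
    and firm: "0 \<le> ip (z - z') ((x - z) - (x' - z'))"
    and \<rho>: "0 < \<rho>" "\<rho> \<le> 2"
    and y: "y = \<rho> \<cdot>\<^sub>v z + (1 - \<rho>) \<cdot>\<^sub>v x" and y': "y' = \<rho> \<cdot>\<^sub>v z' + (1 - \<rho>) \<cdot>\<^sub>v x'"
  shows "ip (y - y') (y - y') \<le> ip (x - x') (x - x')"
proof -
  define a where "a = x - x'"
  define c where "c = z - z'"
  have ac: "a \<in> carrier_vec d" "c \<in> carrier_vec d"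
    using carr by (auto simp: a_def c_def)
  have "y - y' = a - \<rho> \<cdot>\<^sub>v (a - c)"
    unfolding y y' a_def c_def using carr by (intro eq_vecI) (auto simp: algebra_simps)
  then have "ip (y - y') (y - y') = ip a a - 2 * \<rho> * ip c (a - c) - \<rho> * (2 - \<rho>) * ip (a - c) (a - c)"
    using ac by (simp add: ip_simps ip_commute[of c a]) (simp add: algebra_simps)
  moreover have "(x - z) - (x' - z') = a - c"
    unfolding a_def c_def using carr by (intro eq_vecI) auto
  then have "0 \<le> 2 * \<rho> * ip c (a - c)"
    using firm \<rho> by (simp add: c_def)
  moreover have "0 \<le> \<rho> * (2 - \<rho>) * ip (a - c) (a - c)"
    using \<rho> ac by (intro mult_nonneg_nonneg ip_nonneg) auto
  ultimately show ?thesis by (simp add: a_def)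
qed

text \<open>\<open>y k\<close> stands for F(x^k). In the induction, with residuals r, r' and e = x^0
  - x^(k+1), nonexpansiveness between consecutive iterates becomes |e/n - r'|^2 \<le> |e/n - r|^2
  for n = k + 1, while the induction hypothesis becomes |r|^2 \<le> (2/n) <r, e>.\<close>

lemma halpern_anchored:
  assumes x: "\<And>k. x k \<in> carrier_vec d" and y: "\<And>k. y k \<in> carrier_vec d"
    and step: "\<And>k. x (Suc k) = (1 / real (k + 2)) \<cdot>\<^sub>v x 0 + (real (k + 1) / real (k + 2)) \<cdot>\<^sub>v y k"
    and nonexp: "\<And>k. ip (y (Suc k) - y k) (y (Suc k) - y k)
        \<le> ip (x (Suc k) - x k) (x (Suc k) - x k)"
  shows "real k / 2 * ip (x k - y k) (x k - y k) \<le> ip (x k - y k) (x 0 - x k)"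
proof (induction k)
  case 0
  have "x 0 - x 0 = 0 \<cdot>\<^sub>v x 0" using x[of 0] by (intro eq_vecI) auto
  then show ?case using x y by (simp add: ip_smult_right)
next
  case (Suc k)
  \<comment> \<open>n is the index of the new iterate. It is positive even for k = 0, so division by
    n is safe, and the Halpern weights become 1/(n+1) and n/(n+1).\<close>
  define n where "n = real k + 1"
  define e where "e = x 0 - x (Suc k)"
  define r where "r = x k - y k"
  define r' where "r' = x (Suc k) - y (Suc k)"
  have n: "n > 0" by (simp add: n_def)
  have carr: "e \<in> carrier_vec d" "r \<in> carrier_vec d" "r' \<in> carrier_vec d"
    using x y by (auto simp: e_def r_def r'_def)
  have xk: "x k \<in> carrier_vec d" "x 0 \<in> carrier_vec d" "y k \<in> carrier_vec d"
    "y (Suc k) \<in> carrier_vec d" using x y by auto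
  have xS: "x (Suc k) \<in> carrier_vec d" by (rule x)
  have st: "x (Suc k) = (1 / (n + 1)) \<cdot>\<^sub>v x 0 + (n / (n + 1)) \<cdot>\<^sub>v y k"
    using step[of k] by (simp add: n_def add.commute)
  \<comment> \<open>The Halpern step solved for \<open>y k\<close>. Eliminating \<open>y k\<close>
    lets the three differences below be written in e, r and r' alone.\<close>
  have comp: "n * (y k $ i) = (n + 1) * (x (Suc k) $ i) - x 0 $ i" if "i < d" for i
  proof -
    have "x (Suc k) $ i = (1 / (n + 1)) * (x 0 $ i) + (n / (n + 1)) * (y k $ i)"
      unfolding st using xk that by simp
    then show ?thesis using n by (simp add: divide_simps) (simp add: algebra_simps)
  qed
  have v1: "x 0 - x k = ((n + 1) / n) \<cdot>\<^sub>v e - r"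
  proof (rule eq_vecI)
    fix i assume "i < dim_vec (((n + 1) / n) \<cdot>\<^sub>v e - r)"
    then have i: "i < d" using carr by simp
    show "(x 0 - x k) $ i = (((n + 1) / n) \<cdot>\<^sub>v e - r) $ i"
      using comp[OF i] i xk xS n by (simp add: e_def r_def divide_simps) (simp add: algebra_simps)
  qed (use carr xk in auto)
  have v2: "y (Suc k) - y k = (1 / n) \<cdot>\<^sub>v e - r'"
  proof (rule eq_vecI)
    fix i assume "i < dim_vec ((1 / n) \<cdot>\<^sub>v e - r')"
    then have i: "i < d" using carr by simp
    show "(y (Suc k) - y k) $ i = ((1 / n) \<cdot>\<^sub>v e - r') $ i"
      using comp[OF i] i xk xS n by (simp add: e_def r'_def divide_simps) (simp add: algebra_simps)
  qed (use carr xk in auto)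
  have v3: "x (Suc k) - x k = (1 / n) \<cdot>\<^sub>v e - r"
  proof (rule eq_vecI)
    fix i assume "i < dim_vec ((1 / n) \<cdot>\<^sub>v e - r)"
    then have i: "i < d" using carr by simp
    show "(x (Suc k) - x k) $ i = ((1 / n) \<cdot>\<^sub>v e - r) $ i"
      using comp[OF i] i xk xS n by (simp add: e_def r_def divide_simps) (simp add: algebra_simps)
  qed (use carr xk in auto)
  have "(n - 1) / 2 * ip r r \<le> (n + 1) / n * ip r e - ip r r"
    using Suc.IH carr unfolding r_def[symmetric] v1 by (simp add: ip_simps n_def)
  \<comment> \<open>Moving |r|^2 to the left raises the coefficient to (n + 1)/2, so the common
    factor (n + 1)/n cancels.\<close>
  moreover have "(n + 1) / n * (n / 2 * ip r r) = (n - 1) / 2 * ip r r + ip r r"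
    using n by (simp add: field_simps)
  ultimately have "(n + 1) / n * (n / 2 * ip r r) \<le> (n + 1) / n * ip r e"
    by linarith
  then have "n / 2 * ip r r \<le> ip r e"
    using n by (subst (asm) mult_le_cancel_left_pos) auto
  then have "ip r r \<le> 2 / n * ip r e"
    using n by (simp add: field_simps)
  \<comment> \<open>The terms |e|^2 / n^2 of the two expanded squares cancel.\<close>
  moreover have "ip r' r' - 2 / n * ip r' e \<le> ip r r - 2 / n * ip r e"
    using nonexp[of k] carr unfolding v2 v3 by (simp add: ip_simps ip_commute[of e r] ip_commute[of e r'] diff_divide_distrib)
  ultimately have "ip r' r' \<le> 2 / n * ip r' e" by linarith
  then show ?case
    using n unfolding r'_def[symmetric] e_def[symmetric] by (simp add: n_def field_simps)
qed

text \<open>\<open>p\<close> plays the role of a fixed point of F. With y^k - p = a - r, the bound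
  \<open>fejer\<close> expands to |r|^2 \<le> 2 <r, a>; adding half of it to the anchored inequality
  removes a and leaves (n/2)|r|^2 \<le> <r, x^0 - p> with n = k + 1.\<close>

lemma halpern_rate:
  assumes x: "\<And>k. x k \<in> carrier_vec d" and y: "\<And>k. y k \<in> carrier_vec d"
    and step: "\<And>k. x (Suc k) = (1 / real (k + 2)) \<cdot>\<^sub>v x 0 + (real (k + 1) / real (k + 2)) \<cdot>\<^sub>v y k"
    and nonexp: "\<And>k. ip (y (Suc k) - y k) (y (Suc k) - y k)
        \<le> ip (x (Suc k) - x k) (x (Suc k) - x k)"
    and p: "p \<in> carrier_vec d"
    and fejer: "ip (y k - p) (y k - p) \<le> ip (x k - p) (x k - p)"
  shows "op_norm S (x k - y k) \<le> 2 * op_norm S (x 0 - p) / real (k + 1)"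
proof -
  define n where "n = real k + 1"
  define r where "r = x k - y k"
  define a where "a = x k - p"
  define e where "e = x 0 - p"
  have n: "n > 0" by (simp add: n_def)
  have carr: "r \<in> carrier_vec d" "a \<in> carrier_vec d" "e \<in> carrier_vec d"
    using x y p by (auto simp: r_def a_def e_def)
  have xk: "x k \<in> carrier_vec d" "x 0 \<in> carrier_vec d" "y k \<in> carrier_vec d" using x y by auto
  have "y k - p = a - r" "x 0 - x k = e - a"
    unfolding r_def a_def e_def using xk p by (auto intro: eq_vecI)
  moreover note halpern_anchored[of x y k, OF x y step nonexp]
  ultimately have "(n - 1) / 2 * ip r r \<le> ip r e - ip r a" "ip r r \<le> 2 * ip r a"
    using fejer carr
    unfolding a_def[symmetric] r_def[symmetric]
    by (simp_all add: ip_simps ip_commute[of a r] n_def)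
  then have "n / 2 * ip r r \<le> ip r e" by (simp add: field_simps)
  then have le: "n * (n / 2 * ip r r) \<le> n * ip r e"
    using n by (intro mult_left_mono) auto
  \<comment> \<open>This square takes the place of the Cauchy-Schwarz inequality. Together with
    \<open>le\<close> it gives (n/2)^2 |r|^2 \<le> |e|^2, whence the constant 2/n.\<close>
  have "0 \<le> ip ((n / 2) \<cdot>\<^sub>v r - e) ((n / 2) \<cdot>\<^sub>v r - e)"
    using carr by (intro ip_nonneg) auto
  also have "\<dots> = (n / 2)\<^sup>2 * ip r r - n * ip r e + ip e e"
    using carr by (simp add: ip_simps ip_commute[of e r] power2_eq_square) (simp add: field_simps)
  finally have "(n / 2)\<^sup>2 * ip r r \<le> ip e e"
    using le by (simp add: power2_eq_square field_simps)
  then have "sqrt ((n / 2)\<^sup>2 * ip r r) \<le> sqrt (ip e e)" by (rule real_sqrt_le_mono)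
  then have "n / 2 * sqrt (ip r r) \<le> sqrt (ip e e)" using n by (simp add: real_sqrt_mult)
  then show ?thesis
    using n by (simp add: op_norm_def ip_def[symmetric] r_def e_def n_def field_simps)
qed

end

section \<open>Positive definite matrices\<close>

lemma scalar_self_nonneg: "0 \<le> (x :: real vec) \<bullet> x"
  by (simp add: scalar_prod_def sum_nonneg)

lemma scalar_self_zeroD:
  fixes x :: "real vec"
  assumes "x \<bullet> x \<le> 0" and x: "x \<in> carrier_vec n"
  shows "x = 0\<^sub>v n"
proof (rule eq_vecI)
  have "x \<bullet> x = 0" using assms(1) scalar_self_nonneg[of x] by linarith
  then have "\<forall>i\<in>{0..<n}. x $ i * x $ i = 0"
    using x unfolding scalar_prod_def by (subst (asm) sum_nonneg_eq_0_iff) auto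
  then show "x $ i = 0\<^sub>v n $ i" if "i < dim_vec (0\<^sub>v n :: real vec)" for i
    using that by simp
qed (use x in simp)

lemma smult_mult_vec:
  fixes A :: "real mat"
  assumes "A \<in> carrier_mat nr nc" "x \<in> carrier_vec nc"
  shows "(c \<cdot>\<^sub>m A) *\<^sub>v x = c \<cdot>\<^sub>v (A *\<^sub>v x)"
  using assms by (intro eq_vecI) auto

lemma quadratic_form_append:
  fixes x y :: "real vec"
  assumes "x \<in> carrier_vec n" "y \<in> carrier_vec m" "X \<in> carrier_mat n n" "Y \<in> carrier_mat m m"
  shows "(x @\<^sub>v y) \<bullet> (four_block_mat X (0\<^sub>m n m) (0\<^sub>m m n) Y *\<^sub>v (x @\<^sub>v y))
    = x \<bullet> (X *\<^sub>v x) + y \<bullet> (Y *\<^sub>v y)"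
  using assms by (simp add: mult_mat_vec_split scalar_prod_append[where ?n1.0 = n and ?n2.0 = m])

lemma pos_def_imp_pos_semidef: "pos_def n A \<Longrightarrow> pos_semidef n A"
proof -
  assume A: "pos_def n A"
  have "0 \<le> x \<bullet> (A *\<^sub>v x)" if "x \<in> carrier_vec n" for x
    using A that by (cases "x = 0\<^sub>v n") (force simp: pos_def_def sym_mat_def intro: less_imp_le)+
  then show ?thesis using A by (simp add: pos_def_def pos_semidef_def)
qed

lemma pos_def_carrier: "pos_def n A \<Longrightarrow> A \<in> carrier_mat n n"
  by (simp add: pos_def_def sym_mat_def)

lemma pos_def_one: "pos_def n (1\<^sub>m n)"
  using scalar_self_zeroD[of _ n] by (force simp: pos_def_def sym_mat_def not_le)

lemma pos_semidef_smult:
  assumes "0 \<le> c" "pos_semidef n A"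
  shows "pos_semidef n (c \<cdot>\<^sub>m A)"
proof -
  have A: "A \<in> carrier_mat n n" "A\<^sup>T = A" using assms by (auto simp: pos_semidef_def sym_mat_def)
  have "(c \<cdot>\<^sub>m A)\<^sup>T = c \<cdot>\<^sub>m A\<^sup>T" by (intro eq_matI) auto
  then show ?thesis
    using assms A by (auto simp: pos_semidef_def sym_mat_def smult_mult_vec[OF A(1)])
qed

lemma pos_def_smult:
  assumes "0 < c" "pos_def n A"
  shows "pos_def n (c \<cdot>\<^sub>m A)"
proof -
  have A: "A \<in> carrier_mat n n" "A\<^sup>T = A" using assms by (auto simp: pos_def_def sym_mat_def)
  have "(c \<cdot>\<^sub>m A)\<^sup>T = c \<cdot>\<^sub>m A\<^sup>T" by (intro eq_matI) auto
  then show ?thesis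
    using assms A by (auto simp: pos_def_def sym_mat_def smult_mult_vec[OF A(1)])
qed

lemma pos_def_add:
  assumes "pos_semidef n A" "pos_def n B"
  shows "pos_def n (A + B)"
proof -
  have c: "A \<in> carrier_mat n n" "A\<^sup>T = A" "B \<in> carrier_mat n n" "B\<^sup>T = B"
    using assms by (auto simp: pos_semidef_def pos_def_def sym_mat_def)
  have "x \<bullet> ((A + B) *\<^sub>v x) = x \<bullet> (A *\<^sub>v x) + x \<bullet> (B *\<^sub>v x)" if "x \<in> carrier_vec n" for x
    using c that by (simp add: add_mult_distrib_mat_vec[OF c(1,3)] scalar_prod_add_distrib[where n = n])
  then show ?thesis
    using assms c unfolding pos_def_def pos_semidef_def sym_mat_def
    by (auto simp: transpose_add intro: add_nonneg_pos)
qed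

text \<open>The form of Q B Q^T at x is the form of B at Q^T x.\<close>

lemma pos_semidef_congruence:
  assumes B: "pos_semidef m B" and Q: "Q \<in> carrier_mat n m"
  shows "pos_semidef n (Q * B * Q\<^sup>T)"
proof -
  have Bc: "B \<in> carrier_mat m m" "B\<^sup>T = B" using B by (auto simp: pos_semidef_def sym_mat_def)
  have "(Q * B * Q\<^sup>T)\<^sup>T = Q * (Q * B)\<^sup>T"
    using transpose_mult[of "Q * B" n m "Q\<^sup>T" n] Q Bc by simp
  also have "\<dots> = Q * B * Q\<^sup>T"
    using transpose_mult[OF Q Bc(1)] Q Bc by (simp add: assoc_mult_mat[of Q n m B m])
  finally have "(Q * B * Q\<^sup>T)\<^sup>T = Q * B * Q\<^sup>T" .
  moreover have "x \<bullet> ((Q * B * Q\<^sup>T) *\<^sub>v x) = (Q\<^sup>T *\<^sub>v x) \<bullet> (B *\<^sub>v (Q\<^sup>T *\<^sub>v x))"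
    if x: "x \<in> carrier_vec n" for x
  proof -
    have y: "Q\<^sup>T *\<^sub>v x \<in> carrier_vec m" "B *\<^sub>v (Q\<^sup>T *\<^sub>v x) \<in> carrier_vec m"
      using Q Bc by (auto intro!: mult_mat_vec_carrier[of _ m m] simp: x)
    have "(Q * B * Q\<^sup>T) *\<^sub>v x = Q *\<^sub>v (B *\<^sub>v (Q\<^sup>T *\<^sub>v x))"
      using Q Bc x y by (simp add: assoc_mult_mat_vec[of _ n m _ n] assoc_mult_mat_vec[of _ n m _ m])
    then show ?thesis
      using transpose_vec_mult_scalar[OF Q y(2) x] by simp
  qed
  ultimately show ?thesis
    using B Q Bc unfolding pos_semidef_def sym_mat_def
    by (auto intro!: mult_carrier_mat[of _ _ m])
qed

lemma pos_semidef_mult_transpose: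
  assumes Q: "Q \<in> carrier_mat n m"
  shows "pos_semidef n (Q * Q\<^sup>T)"
  using pos_semidef_congruence[OF pos_def_imp_pos_semidef[OF pos_def_one] Q] Q by simp

lemma pos_def_block_diag:
  assumes X: "pos_def n X" and Y: "pos_def m Y"
  shows "pos_def (n + m) (four_block_mat X (0\<^sub>m n m) (0\<^sub>m m n) Y)"
proof -
  have c: "X \<in> carrier_mat n n" "X\<^sup>T = X" "Y \<in> carrier_mat m m" "Y\<^sup>T = Y"
    using assms by (auto simp: pos_def_def sym_mat_def)
  let ?M = "four_block_mat X (0\<^sub>m n m) (0\<^sub>m m n) Y"
  have z: "0\<^sub>v n @\<^sub>v 0\<^sub>v m = (0\<^sub>v (n + m) :: real vec)" by (intro eq_vecI) auto
  have nn: "0 \<le> v \<bullet> (X *\<^sub>v v)" "0 \<le> w \<bullet> (Y *\<^sub>v w)"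
    if "v \<in> carrier_vec n" "w \<in> carrier_vec m" for v w
    using that pos_def_imp_pos_semidef[OF X] pos_def_imp_pos_semidef[OF Y]
    by (auto simp: pos_semidef_def)
  have "x \<noteq> 0\<^sub>v (n + m) \<longrightarrow> 0 < x \<bullet> (?M *\<^sub>v x)" if xc: "x \<in> carrier_vec (n + m)" for x
  proof
    obtain v w where x: "x = v @\<^sub>v w" and v: "v \<in> carrier_vec n" and w: "w \<in> carrier_vec m"
      using vec_first_last_append[OF xc] by (metis vec_first_carrier vec_last_carrier)
    assume "x \<noteq> 0\<^sub>v (n + m)"
    then have "v \<noteq> 0\<^sub>v n \<or> w \<noteq> 0\<^sub>v m" using x z by auto
    then show "0 < x \<bullet> (?M *\<^sub>v x)"
      unfolding x quadratic_form_append[OF v w c(1,3)]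
      using nn[OF v w] X Y v w unfolding pos_def_def
      by (auto intro: add_pos_nonneg add_nonneg_pos)
  qed
  then show ?thesis
    using c by (simp add: pos_def_def sym_mat_def transpose_four_block_mat[OF c(1) _ _ c(3)])
qed

text \<open>A nonzero kernel vector would annihilate the quadratic form, so A is invertible and
  \<open>mat_inverse\<close> does not return \<open>None\<close>. The inverse B is again symmetric,
  and B = B A B^T exhibits it as a congruence of A.\<close>

lemma pos_def_mat_inverse:
  assumes A: "pos_def n A"
  obtains B where "mat_inverse A = Some B" "pos_semidef n B"
proof -
  have c: "A \<in> carrier_mat n n" "A\<^sup>T = A" using A by (auto simp: pos_def_def sym_mat_def)
  have "det A \<noteq> 0"
    using A c by (force simp: det_0_iff_vec_prod_zero[OF c(1)] pos_def_def)
  then have "A \<in> Units (ring_mat TYPE(real) n ())" by (rule det_non_zero_imp_unit[OF c(1)])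
  then obtain B where B: "mat_inverse A = Some B"
    using mat_inverse(1)[OF c(1), where b = "()"] by (cases "mat_inverse A") auto
  then have AB: "A * B = 1\<^sub>m n" "B * A = 1\<^sub>m n" and Bc: "B \<in> carrier_mat n n"
    using mat_inverse(2)[OF c(1)] by auto
  have BT: "B\<^sup>T * A = 1\<^sub>m n"
    using AB(1) c Bc by (metis transpose_mult transpose_one)
  have "B\<^sup>T = B\<^sup>T * (A * B)" using AB Bc by simp
  also have "\<dots> = B" using BT Bc c by (simp flip: assoc_mult_mat[of "B\<^sup>T" n n A n B n])
  finally have sym: "B\<^sup>T = B" .
  have "B * A * B\<^sup>T = B" using sym AB Bc by simp
  then have "pos_semidef n B"
    using pos_semidef_congruence[OF pos_def_imp_pos_semidef[OF A] Bc] by simp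
  then show ?thesis using that B by blast
qed

section \<open>The spaces of the problem\<close>

lemma append_cols_carrier:
  "A \<in> carrier_mat n k \<Longrightarrow> B \<in> carrier_mat n l \<Longrightarrow> A @\<^sub>c B \<in> carrier_mat n (k + l)"
  unfolding append_cols_def by (intro carrier_matI) simp_all

lemma stack_rows_carrier:
  assumes "\<And>A. A \<in> set As \<Longrightarrow> dim_col A = nc"
  shows "stack_rows nc As \<in> carrier_mat (\<Sum>A\<leftarrow>As. dim_row A) nc"
  using assms
proof (induction As)
  case (Cons A As)
  then have "A @\<^sub>r stack_rows nc As \<in> carrier_mat (dim_row A + (\<Sum>A\<leftarrow>As. dim_row A)) nc"
    by (intro carrier_append_rows) (auto intro: carrier_matI)
  then show ?case by (simp add: stack_rows_def)
qed (simp add: stack_rows_def)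

lemma stack_vecs_Cons [simp]: "stack_vecs (v # vs) = v @\<^sub>v stack_vecs vs"
  by (simp add: stack_vecs_def)

lemma stack_vecs_Nil [simp]: "stack_vecs [] = 0\<^sub>v 0"
  by (simp add: stack_vecs_def)

lemma stack_vecs_carrier:
  "set vs \<subseteq> carrier_vec d \<Longrightarrow> stack_vecs vs \<in> carrier_vec (length vs * d)"
  by (induction vs) auto

lemma append_vec_smult:
  "c \<cdot>\<^sub>v (v @\<^sub>v w) = (c \<cdot>\<^sub>v v :: real vec) @\<^sub>v (c \<cdot>\<^sub>v w)"
  by (intro eq_vecI) auto

lemma append_vec_diff:
  fixes v v' w w' :: "real vec"
  assumes "v \<in> carrier_vec n" "v' \<in> carrier_vec n" "w \<in> carrier_vec m" "w' \<in> carrier_vec m"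
  shows "(v @\<^sub>v w) - (v' @\<^sub>v w') = (v - v') @\<^sub>v (w - w')"
  using assms by (intro eq_vecI) auto

section \<open>The cone \<Gamma> is nonempty and convex\<close>

lemma svec_index:
  assumes "X \<in> carrier_mat k k" "r < tri k" "lower_positions k ! r = (i, j)"
  shows "svec X $ r = (if i = j then X $$ (i, j) else sqrt 2 * X $$ (i, j))"
  using assms by (simp add: svec_def lower_positions_length vec_of_list_index)

lemma svec_lincomb:
  assumes X: "X \<in> carrier_mat k k" and Y: "Y \<in> carrier_mat k k"
  shows "svec (a \<cdot>\<^sub>m X + b \<cdot>\<^sub>m Y) = a \<cdot>\<^sub>v svec X + b \<cdot>\<^sub>v svec Y"
proof (rule eq_vecI)
  fix r assume "r < dim_vec (a \<cdot>\<^sub>v svec X + b \<cdot>\<^sub>v svec Y)"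
  then have r: "r < tri k" using carrier_matD(1)[OF Y] by (simp add: dim_svec)
  then obtain i j where ij: "lower_positions k ! r = (i, j)" "j \<le> i" "i < k"
    by (rule lower_position_bounds)
  have Z: "a \<cdot>\<^sub>m X + b \<cdot>\<^sub>m Y \<in> carrier_mat k k"
    by (rule add_carrier_mat[OF smult_carrier_mat[OF Y]])
  have "(a \<cdot>\<^sub>m X + b \<cdot>\<^sub>m Y) $$ (i, j) = a * X $$ (i, j) + b * Y $$ (i, j)"
    using carrier_matD[OF X] carrier_matD[OF Y] ij(2,3) by simp
  moreover have "(a \<cdot>\<^sub>v svec X + b \<cdot>\<^sub>v svec Y) $ r = a * svec X $ r + b * svec Y $ r"
    using carrier_matD(1)[OF X] carrier_matD(1)[OF Y] r by (simp add: dim_svec)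
  ultimately show "svec (a \<cdot>\<^sub>m X + b \<cdot>\<^sub>m Y) $ r = (a \<cdot>\<^sub>v svec X + b \<cdot>\<^sub>v svec Y) $ r"
    unfolding svec_index[OF X r ij(1)] svec_index[OF Y r ij(1)] svec_index[OF Z r ij(1)]
    by (cases "i = j") (simp_all add: distrib_left mult.left_commute)
next
  show "dim_vec (svec (a \<cdot>\<^sub>m X + b \<cdot>\<^sub>m Y)) = dim_vec (a \<cdot>\<^sub>v svec X + b \<cdot>\<^sub>v svec Y)"
    using carrier_matD(1)[OF X] carrier_matD(1)[OF Y] by (simp add: dim_svec)
qed

lemma pos_semidef_carrier: "pos_semidef k X \<Longrightarrow> X \<in> carrier_mat k k"
  by (simp add: pos_semidef_def sym_mat_def)

lemma svec_carrier: "X \<in> carrier_mat k k \<Longrightarrow> svec X \<in> carrier_vec (tri k)"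
  by (intro carrier_vecI) (simp add: dim_svec)

lemma psd_cone_carrier: "psd_cone k \<subseteq> carrier_vec (tri k)"
  unfolding psd_cone_def using svec_carrier pos_semidef_carrier by blast

lemma psd_cone_nonempty: "psd_cone k \<noteq> {}"
proof -
  have "x \<bullet> (0\<^sub>m k k *\<^sub>v x) = 0" if "x \<in> carrier_vec k" for x :: "real vec"
  proof -
    have "0\<^sub>m k k *\<^sub>v x = 0\<^sub>v k" using that by (intro eq_vecI) simp_all
    then show ?thesis using that by simp
  qed
  then have "pos_semidef k (0\<^sub>m k k)"
    by (simp add: pos_semidef_def sym_mat_def)
  then show ?thesis unfolding psd_cone_def by blast
qed

text \<open>The conic form of convexity: nonnegative weights preserve semidefiniteness and
  \<open>svec\<close> is linear. \<open>Gam_convex\<close> applies it block by block.\<close>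

lemma psd_cone_convex:
  assumes "x \<in> psd_cone k" "y \<in> psd_cone k" "0 \<le> a" "0 \<le> b"
  shows "a \<cdot>\<^sub>v x + b \<cdot>\<^sub>v y \<in> psd_cone k"
proof -
  obtain X Y where X: "pos_semidef k X" "x = svec X" and Y: "pos_semidef k Y" "y = svec Y"
    using assms by (auto simp: psd_cone_def)
  have c: "X \<in> carrier_mat k k" "X\<^sup>T = X" "Y \<in> carrier_mat k k" "Y\<^sup>T = Y"
    using X Y by (auto simp: pos_semidef_def sym_mat_def)
  have "v \<bullet> ((a \<cdot>\<^sub>m X + b \<cdot>\<^sub>m Y) *\<^sub>v v) = a * (v \<bullet> (X *\<^sub>v v)) + b * (v \<bullet> (Y *\<^sub>v v))"
    if v: "v \<in> carrier_vec k" for v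
  proof -
    have "(a \<cdot>\<^sub>m X + b \<cdot>\<^sub>m Y) *\<^sub>v v = a \<cdot>\<^sub>v (X *\<^sub>v v) + b \<cdot>\<^sub>v (Y *\<^sub>v v)"
      using c v by (intro eq_vecI) (auto simp: add_scalar_prod_distrib[where n = k])
    then show ?thesis
      using c v by (simp add: scalar_prod_add_distrib[where n = k])
  qed
  moreover have "(a \<cdot>\<^sub>m X + b \<cdot>\<^sub>m Y)\<^sup>T = a \<cdot>\<^sub>m X\<^sup>T + b \<cdot>\<^sub>m Y\<^sup>T"
    using c(1,3) by (intro eq_matI) auto
  ultimately have "pos_semidef k (a \<cdot>\<^sub>m X + b \<cdot>\<^sub>m Y)"
    using X(1) Y(1) c assms(3,4) by (simp add: pos_semidef_def sym_mat_def)
  then show ?thesis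
    unfolding psd_cone_def X(2) Y(2) svec_lincomb[OF c(1,3), symmetric] by blast
qed

lemma stack_vecs_lincomb:
  fixes a b :: real
  assumes "length xs = length ys" "set xs \<subseteq> carrier_vec d" "set ys \<subseteq> carrier_vec d"
  shows "a \<cdot>\<^sub>v stack_vecs xs + b \<cdot>\<^sub>v stack_vecs ys
    = stack_vecs (map2 (\<lambda>x y. a \<cdot>\<^sub>v x + b \<cdot>\<^sub>v y) xs ys)"
  using assms
proof (induction xs ys rule: list_induct2)
  case (Cons x xs y ys)
  have "stack_vecs xs \<in> carrier_vec (length xs * d)" "stack_vecs ys \<in> carrier_vec (length xs * d)"
    using Cons stack_vecs_carrier[of xs d] stack_vecs_carrier[of ys d] by auto
  then show ?case
    using Cons by (simp add: append_vec_smult append_vec_add[where n = d and m = "length xs * d"])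
qed auto

lemma Gam_carrier: "Gam P \<subseteq> spaceV P"
proof
  fix x assume "x \<in> Gam P"
  then obtain g gs where x: "x = g @\<^sub>v stack_vecs gs" and g: "g \<in> psd_cone (dp P)"
    and gs: "length gs = nvert P" "set gs \<subseteq> psd_cone (dn P)"
    by (auto simp: Gam_def)
  have "stack_vecs gs \<in> carrier_vec (dZ P)"
    unfolding dZ_def gs(1)[symmetric] using gs(2) psd_cone_carrier by (intro stack_vecs_carrier) blast
  then show "x \<in> spaceV P"
    using g psd_cone_carrier unfolding x spaceV_def dV_def by (intro append_carrier_vec) auto
qed

lemma GamD: "x \<in> Gam P \<Longrightarrow> x \<in> carrier_vec (dV P)"
  using Gam_carrier unfolding spaceV_def by blast

text \<open>Provides a point where the indicator is finite. This forces minimisers of the first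
  subproblem, and all points with a subgradient of the indicator, to lie in \<Gamma>: an infinite
  function would have every point as minimiser.\<close>

lemma Gam_nonempty: "Gam P \<noteq> {}"
proof -
  obtain g where "g \<in> psd_cone (dp P)" using psd_cone_nonempty by blast
  moreover obtain h where "h \<in> psd_cone (dn P)" using psd_cone_nonempty by blast
  ultimately have "g @\<^sub>v stack_vecs (replicate (nvert P) h) \<in> Gam P"
    unfolding Gam_def by (auto intro!: exI[of _ g] exI[of _ "replicate (nvert P) h"])
  then show ?thesis by blast
qed

lemma Gam_convex:
  assumes "x \<in> Gam P" "y \<in> Gam P" "0 \<le> a" "0 \<le> b"
  shows "a \<cdot>\<^sub>v x + b \<cdot>\<^sub>v y \<in> Gam P"
proof -
  obtain g gs where x: "x = g @\<^sub>v stack_vecs gs" and g: "g \<in> psd_cone (dp P)"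
    and gs: "length gs = nvert P" "set gs \<subseteq> psd_cone (dn P)"
    using assms(1) by (auto simp: Gam_def)
  obtain h hs where y: "y = h @\<^sub>v stack_vecs hs" and h: "h \<in> psd_cone (dp P)"
    and hs: "length hs = nvert P" "set hs \<subseteq> psd_cone (dn P)"
    using assms(2) by (auto simp: Gam_def)
  let ?l = "map2 (\<lambda>x y. a \<cdot>\<^sub>v x + b \<cdot>\<^sub>v y) gs hs"
  have c: "set gs \<subseteq> carrier_vec (tri (dn P))" "set hs \<subseteq> carrier_vec (tri (dn P))"
    using gs hs psd_cone_carrier by blast+
  have "stack_vecs gs \<in> carrier_vec (dZ P)" "stack_vecs hs \<in> carrier_vec (dZ P)"
    using stack_vecs_carrier[OF c(1)] stack_vecs_carrier[OF c(2)] gs hs by (auto simp: dZ_def)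
  moreover have "g \<in> carrier_vec (tri (dp P))" "h \<in> carrier_vec (tri (dp P))"
    using g h psd_cone_carrier by blast+
  ultimately have "a \<cdot>\<^sub>v x + b \<cdot>\<^sub>v y
      = (a \<cdot>\<^sub>v g + b \<cdot>\<^sub>v h) @\<^sub>v (a \<cdot>\<^sub>v stack_vecs gs + b \<cdot>\<^sub>v stack_vecs hs)"
    unfolding x y
    by (simp add: append_vec_smult append_vec_add[where n = "tri (dp P)" and m = "dZ P"])
  also have "\<dots> = (a \<cdot>\<^sub>v g + b \<cdot>\<^sub>v h) @\<^sub>v stack_vecs ?l"
    using stack_vecs_lincomb[OF _ c] gs hs by simp
  also have "\<dots> \<in> Gam P"
  proof -
    have "z \<in> psd_cone (dn P)" if z: "z \<in> set ?l" for z
    proof -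
      obtain x y where xy: "(x, y) \<in> set (zip gs hs)" and "z = a \<cdot>\<^sub>v x + b \<cdot>\<^sub>v y"
        using z by auto
      moreover have "x \<in> psd_cone (dn P)" "y \<in> psd_cone (dn P)"
        using set_zip_leftD[OF xy] set_zip_rightD[OF xy] gs(2) hs(2) by blast+
      ultimately show ?thesis using psd_cone_convex assms(3,4) by blast
    qed
    then have "set ?l \<subseteq> psd_cone (dn P)" by (rule subsetI)
    moreover have "length ?l = nvert P" using gs hs by simp
    ultimately show ?thesis
      using psd_cone_convex[OF g h assms(3,4)] unfolding Gam_def by blast
  qed
  finally show ?thesis .
qed

section \<open>Dimensions of the operators and the data vectors\<close>

lemma svec_mat_carrier: "svec_mat k \<in> carrier_mat (tri k) (k\<^sup>2)"
  using is_svec_mat_svec_mat by (simp add: is_svec_mat_def)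

lemma Aw_carrier: "Aw P \<in> carrier_mat (dZ P) (tri (dp P))"
proof -
  have r: "dim_row (Aw_block P i) = tri (dn P)" "dim_col (Aw_block P i) = tri (dp P)" for i
    using svec_mat_carrier[of "dn P"] svec_mat_carrier[of "dp P"] by (auto simp: Aw_block_def)
  have "(\<Sum>A\<leftarrow>map (Aw_block P) [1..<nvert P + 1]. dim_row A) = dZ P"
    by (simp add: r comp_def dZ_def sum_list_triv)
  moreover have "stack_rows (tri (dp P)) (map (Aw_block P) [1..<nvert P + 1])
      \<in> carrier_mat (\<Sum>A\<leftarrow>map (Aw_block P) [1..<nvert P + 1]. dim_row A) (tri (dp P))"
    by (rule stack_rows_carrier) (use r(2) in auto)
  ultimately show ?thesis by (simp only: Aw_def)
qed

lemma Bw_carrier: "Bw P \<in> carrier_mat (dY P) (tri (dp P))"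
proof -
  have r: "dim_row (Bw_block P q) = (case q of (i, l) \<Rightarrow> dim_row (matV P i) * dim_row (matV P l))"
    "dim_col (Bw_block P q) = tri (dp P)" for q
    using svec_mat_carrier[of "dp P"] by (auto simp: Bw_block_def kronecker_def mult.commute split: prod.split)
  have "(\<Sum>A\<leftarrow>map (Bw_block P) (index_pairs (dm P)). dim_row A) = dY P"
    by (simp add: r comp_def dY_def)
  moreover have "stack_rows (tri (dp P)) (map (Bw_block P) (index_pairs (dm P)))
      \<in> carrier_mat (\<Sum>A\<leftarrow>map (Bw_block P) (index_pairs (dm P)). dim_row A) (tri (dp P))"
    by (rule stack_rows_carrier) (use r(2) in auto)
  ultimately show ?thesis by (simp only: Bw_def)
qed

lemma opA_carrier: "opA P \<in> carrier_mat (dZ P) (dV P)"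
  unfolding opA_def dV_def by (rule append_cols_carrier[OF Aw_carrier one_carrier_mat])

lemma opB_carrier: "opB P \<in> carrier_mat (dY P) (dV P)"
  unfolding opB_def dV_def by (rule append_cols_carrier[OF Bw_carrier zero_carrier_mat])

lemma Atilde_adj_carrier: "Atilde_adj P \<in> carrier_mat (dV P) (dZ P + dY P)"
  unfolding Atilde_adj_def
  by (rule append_cols_carrier[OF transpose_carrier_mat[THEN iffD2, OF opA_carrier]
      transpose_carrier_mat[THEN iffD2, OF opB_carrier]])

lemma btilde_carrier: "problem_data P \<Longrightarrow> btilde P \<in> carrier_vec (dZ P + dY P)"
proof -
  assume "problem_data P"
  then have "dim_row (matB1 P) = dn P" by (auto simp: problem_data_def)
  then have "vec_b P \<in> carrier_vec (tri (dn P))"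
    by (intro carrier_vecI) (simp add: vec_b_def dim_svec)
  then have "vec_bw P \<in> carrier_vec (dZ P)"
    using stack_vecs_carrier[of "replicate (nvert P) (vec_b P)" "tri (dn P)"]
    by (simp add: vec_bw_def dZ_def subset_iff)
  then show ?thesis unfolding btilde_def by (rule append_carrier_vec[OF _ zero_carrier_vec])
qed

lemma rtilde_carrier: "problem_data P \<Longrightarrow> rtilde P \<in> carrier_vec (dV P)"
proof -
  assume "problem_data P"
  then have "dim_col (matC P) = dn P" "dim_col (matD P) = dm P" by (auto simp: problem_data_def)
  then have "vec_r P \<in> carrier_vec (tri (dp P))"
    by (intro carrier_vecI) (simp add: vec_r_def dim_svec matPhi_def dp_def)
  then show ?thesis unfolding rtilde_def dV_def by (rule append_carrier_vec[OF _ zero_carrier_vec])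
qed

section \<open>The proximal operators\<close>

lemma opS2_i_pos_def:
  assumes "0 < \<sigma>" "0 < \<mu>0"
  shows "pos_def (dZ P + dY P) (opS2_i P \<sigma> \<mu>0)"
  unfolding opS2_i_def diag_ZY_def
  using assms by (intro pos_def_smult pos_def_block_diag pos_def_one mult_pos_pos)

text \<open>The diagonal blocks of \<open>opQd\<close> are Gram matrices shifted by positive
  multiples of the identity. Hence its inverse exists, so that \<open>the\<close> in
  \<open>opS2_ii\<close> yields it, and is semidefinite. The first summand is then a congruence of a
  semidefinite matrix, and the positive diagonal added to it makes the sum definite.\<close>

lemma opS2_ii_pos_def:
  assumes "0 < \<sigma>" "0 < \<mu>2" "0 < \<mu>3"
  shows "pos_def (dZ P + dY P) (opS2_ii P \<sigma> \<mu>2 \<mu>3)"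
proof -
  have "pos_def (dZ P + dY P) (opQd P \<sigma> \<mu>2 \<mu>3)"
    unfolding opQd_def diag_ZY_def using assms
    by (intro pos_def_smult pos_def_block_diag pos_def_add pos_semidef_mult_transpose[of _ _ "dV P"]
        opA_carrier opB_carrier pos_def_one)
  then obtain R where R: "mat_inverse (opQd P \<sigma> \<mu>2 \<mu>3) = Some R" "pos_semidef (dZ P + dY P) R"
    by (rule pos_def_mat_inverse)
  have Q: "opQu P \<sigma> \<in> carrier_mat (dZ P + dY P) (dZ P + dY P)"
    unfolding opQu_def
    by (rule smult_carrier_mat, rule four_block_carrier_mat[OF zero_carrier_mat zero_carrier_mat])
  show ?thesis
    unfolding opS2_ii_def R(1) option.sel diag_ZY_def using assms
    by (intro pos_def_add pos_semidef_congruence[OF R(2) Q] pos_def_smult pos_def_block_diag pos_def_one)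
qed

section \<open>Optimality conditions of the two subproblems\<close>

lemma op_norm_scalar_sq:
  assumes "0 < \<mu>" "x \<in> carrier_vec (dV P)"
  shows "(op_norm (opS1 P \<mu>) x)\<^sup>2 = \<mu> * (x \<bullet> x)"
proof -
  have "x \<bullet> (opS1 P \<mu> *\<^sub>v x) = \<mu> * (x \<bullet> x)"
    using assms by (simp add: opS1_def smult_mult_vec[where nr = "dV P" and nc = "dV P"])
  then show ?thesis
    using assms(1) by (simp add: op_norm_def scalar_self_nonneg)
qed

lemma scalar_self_line:
  fixes x h :: "real vec"
  assumes "x \<in> carrier_vec n" "h \<in> carrier_vec n"
  shows "(x + t \<cdot>\<^sub>v h) \<bullet> (x + t \<cdot>\<^sub>v h) = x \<bullet> x + 2 * t * (x \<bullet> h) + t\<^sup>2 * (h \<bullet> h)"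
  using assms
  by (simp add: add_scalar_prod_distrib[where n = n] scalar_prod_add_distrib[where n = n]
      comm_scalar_prod[of h n x] power2_eq_square algebra_simps)

lemma vec_shift:
  fixes v g x r :: "real vec"
  assumes "v \<in> carrier_vec n" "g \<in> carrier_vec n" "x \<in> carrier_vec n" "r \<in> carrier_vec n"
  shows "v + t \<cdot>\<^sub>v g + x - r = (v + x - r) + t \<cdot>\<^sub>v g"
  using assms by (intro eq_vecI) auto

text \<open>The one-sided derivative at a minimum: divide by t and let t tend to 0. The range 0 < t
  \<le> 1 fits segments that stay inside a convex set.\<close>

lemma first_order_nonneg:
  fixes a c :: real
  assumes "\<And>t. 0 < t \<Longrightarrow> t \<le> 1 \<Longrightarrow> 0 \<le> t * a + t\<^sup>2 * c"
  shows "0 \<le> a"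
proof (rule ccontr)
  assume "\<not> 0 \<le> a"
  then have a: "a < 0" by simp
  \<comment> \<open>From t D \<le> -a it follows that t |c| < -a/2, so the quadratic term cannot
    compensate a. The summand 1 keeps D positive when c = 0.\<close>
  define D where "D = 2 * (\<bar>c\<bar> + 1)"
  define t where "t = min 1 (- a / D)"
  have D: "0 < D" by (simp add: D_def)
  have t: "0 < t" "t \<le> 1" using a D by (auto simp: t_def intro!: divide_neg_pos)
  have "t \<le> - a / D" by (simp add: t_def)
  then have "t * D \<le> - a"
    using D by (simp only: pos_le_divide_eq)
  moreover have "t * c \<le> t * \<bar>c\<bar>" using t by (intro mult_left_mono) auto
  moreover have "t * D = 2 * t + 2 * (t * \<bar>c\<bar>)" by (simp add: D_def algebra_simps)
  ultimately have "a + t * c < 0" using t a by linarith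
  then have "t * (a + t * c) < 0" using t by (intro mult_pos_neg)
  then show False using assms[OF t] by (simp add: power2_eq_square algebra_simps)
qed

lemma residual_carrier:
  assumes "problem_data P" "x \<in> spaceV P" "y \<in> spaceZY P"
  shows "residual P x y \<in> carrier_vec (dV P)"
  unfolding residual_def using assms mult_mat_vec_carrier[OF Atilde_adj_carrier, of y P] rtilde_carrier
  by (auto simp: spaceV_def spaceZY_def)

text \<open>Comparing the minimiser with points on segments inside \<Gamma> shows that minus the
  gradient of the smooth part lies in the normal cone of \<Gamma>. The vector w + \<sigma>
  \<open>residual P xb y\<close> is the updated multiplier.\<close>

lemma primal_step_optimality:
  assumes data: "problem_data P" and \<mu>: "0 < \<mu>1"
    and carr: "x \<in> spaceV P" "y \<in> spaceZY P" "w \<in> spaceV P"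
    and argmin: "is_arg_min
        (\<lambda>z. aug_lagrangian P \<sigma> z y w + ereal (1 / 2 * (op_norm (opS1 P \<mu>1) (z - x))\<^sup>2))
        (\<lambda>z. z \<in> spaceV P) xb"
  shows "xb \<in> Gam P"
    and "\<mu>1 \<cdot>\<^sub>v (x - xb) - (w + \<sigma> \<cdot>\<^sub>v residual P xb y)
      \<in> subdifferential (dV P) (indicator_fun (Gam P)) xb"
proof -
  let ?n = "dV P"
  define f where "f = (\<lambda>z. aug_lagrangian P \<sigma> z y w
    + ereal (1 / 2 * (op_norm (opS1 P \<mu>1) (z - x))\<^sup>2))"
  define q where "q = (\<lambda>z. w \<bullet> residual P z y + \<sigma> / 2 * (residual P z y \<bullet> residual P z y)
    + \<mu>1 / 2 * ((z - x) \<bullet> (z - x)))"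
  have xb: "xb \<in> spaceV P" and min: "\<not> f z < f xb" if "z \<in> spaceV P" for z
    using argmin that unfolding is_arg_min_def f_def by auto
  obtain g where g: "g \<in> Gam P" using Gam_nonempty by blast
  have gV: "g \<in> spaceV P" using g Gam_carrier by blast
  note xb = xb[OF gV]
  have inn: "f z = ereal (btilde P \<bullet> y + q z)" if z: "z \<in> Gam P" for z
  proof -
    have "z - x \<in> carrier_vec ?n"
      using GamD[OF z] carr by (simp add: spaceV_def)
    then show ?thesis
      using z \<mu> unfolding f_def q_def aug_lagrangian_def
      by (simp add: indicator_fun_def op_norm_scalar_sq)
  qed
  have out: "f z = \<infinity>" if "z \<notin> Gam P" for z
    using that by (simp add: f_def aug_lagrangian_def indicator_fun_def)
  show xbG: "xb \<in> Gam P"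
    using min[OF gV] inn[OF g] out[of xb] by (cases "xb \<in> Gam P") auto
  define R where "R = residual P xb y"
  \<comment> \<open>The gradient of \<open>q\<close> at \<open>xb\<close>; since \<open>q\<close> is
    quadratic, its expansion along h below is exact, with remainder t^2 (\<sigma> + \<mu>1)/2
    |h|^2.\<close>
  define gr where "gr = (w + \<sigma> \<cdot>\<^sub>v R) + \<mu>1 \<cdot>\<^sub>v (xb - x)"
  have R: "R \<in> carrier_vec ?n" unfolding R_def by (rule residual_carrier[OF data xb carr(2)])
  have c: "w \<in> carrier_vec ?n" "x \<in> carrier_vec ?n" "xb \<in> carrier_vec ?n" "xb - x \<in> carrier_vec ?n"
    using carr xb by (auto simp: spaceV_def)
  have gr: "gr \<in> carrier_vec ?n" using c R by (simp add: gr_def)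
  have vi: "0 \<le> gr \<bullet> (z - xb)" if z: "z \<in> Gam P" for z
  proof (rule first_order_nonneg)
    fix t :: real assume t: "0 < t" "t \<le> 1"
    have zc: "z \<in> carrier_vec ?n" using z by (rule GamD)
    define h where "h = z - xb"
    have h: "h \<in> carrier_vec ?n" using zc c by (simp add: h_def)
    have line: "xb + t \<cdot>\<^sub>v h = (1 - t) \<cdot>\<^sub>v xb + t \<cdot>\<^sub>v z"
      unfolding h_def using zc c by (intro eq_vecI) (auto simp: algebra_simps)
    have pG: "xb + t \<cdot>\<^sub>v h \<in> Gam P"
      unfolding line using t by (intro Gam_convex xbG z) auto
    have A: "Atilde_adj P *\<^sub>v y \<in> carrier_vec ?n" "rtilde P \<in> carrier_vec ?n"
      using mult_mat_vec_carrier[OF Atilde_adj_carrier, of y P] rtilde_carrier[OF data] carr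
      by (auto simp: spaceZY_def)
    have res: "residual P (xb + t \<cdot>\<^sub>v h) y = R + t \<cdot>\<^sub>v h"
      unfolding R_def residual_def using A c h by (intro eq_vecI) auto
    have dx: "xb + t \<cdot>\<^sub>v h - x = (xb - x) + t \<cdot>\<^sub>v h"
      using c h by (intro eq_vecI) auto
    have "q xb \<le> q (xb + t \<cdot>\<^sub>v h)"
      using min[of "xb + t \<cdot>\<^sub>v h"] inn[OF pG] inn[OF xbG] GamD[OF pG]
      by (simp add: spaceV_def not_less)
    also have "q (xb + t \<cdot>\<^sub>v h) = q xb + t * (gr \<bullet> h) + t\<^sup>2 * ((\<sigma> / 2 + \<mu>1 / 2) * (h \<bullet> h))"
      unfolding q_def res dx R_def[symmetric] scalar_self_line[OF R h] scalar_self_line[OF c(4) h] gr_def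
      using c R h
      by (simp add: add_scalar_prod_distrib[where n = ?n] scalar_prod_add_distrib[where n = ?n]
          algebra_simps)
    finally show "0 \<le> t * (gr \<bullet> (z - xb)) + t\<^sup>2 * ((\<sigma> / 2 + \<mu>1 / 2) * (h \<bullet> h))"
      by (simp add: h_def)
  qed
  have neg: "\<mu>1 \<cdot>\<^sub>v (x - xb) - (w + \<sigma> \<cdot>\<^sub>v residual P xb y) = - gr"
    unfolding gr_def R_def[symmetric] using c R by (intro eq_vecI) (auto simp: algebra_simps)
  \<comment> \<open>The subgradient inequality needs checking at points of \<Gamma> only; elsewhere
    the indicator is infinite.\<close>
  have "- gr \<bullet> (z - xb) \<le> 0" if "z \<in> Gam P" for z
    using vi[OF that] gr c GamD[OF that] by simp
  then show "\<mu>1 \<cdot>\<^sub>v (x - xb) - (w + \<sigma> \<cdot>\<^sub>v residual P xb y)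
      \<in> subdifferential ?n (indicator_fun (Gam P)) xb"
    unfolding neg subdifferential_def indicator_fun_def using gr xbG by auto
qed

text \<open>Stationarity of an unconstrained quadratic: membership of \<open>x\<close> in \<Gamma>
  makes the indicator vanish, so the objective is the real function \<open>q\<close>.\<close>

lemma dual_step_optimality:
  assumes data: "problem_data P" and S2: "pos_def (dZ P + dY P) S2"
    and carr: "x \<in> Gam P" "y \<in> spaceZY P" "w \<in> spaceV P"
    and argmin: "is_arg_min
        (\<lambda>z. aug_lagrangian P \<sigma> x z w + ereal (1 / 2 * (op_norm S2 (z - y))\<^sup>2))
        (\<lambda>z. z \<in> spaceZY P) yb"
  shows "btilde P + Atilde P *\<^sub>v (w + \<sigma> \<cdot>\<^sub>v residual P x yb) + S2 *\<^sub>v (yb - y) = 0\<^sub>v (dZ P + dY P)"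
proof -
  let ?n = "dV P"
  let ?m = "dZ P + dY P"
  let ?A = "Atilde_adj P"
  interpret psd_form ?m S2
    by unfold_locales (rule pos_def_imp_pos_semidef[OF S2])
  define q where "q = (\<lambda>z. btilde P \<bullet> z + w \<bullet> residual P x z
    + \<sigma> / 2 * (residual P x z \<bullet> residual P x z) + 1 / 2 * ip (z - y) (z - y))"
  define R where "R = residual P x yb"
  define gr where "gr = btilde P + Atilde P *\<^sub>v (w + \<sigma> \<cdot>\<^sub>v R) + S2 *\<^sub>v (yb - y)"
  \<comment> \<open>Testing along the negative gradient alone suffices: a nonnegative derivative
    there reads -|gr|^2 \<ge> 0.\<close>
  define h where "h = - gr"
  define e where "e = yb - y"
  have xV: "x \<in> spaceV P" using carr Gam_carrier by blast
  have yb: "yb \<in> spaceZY P" using argmin by (simp add: is_arg_min_def)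
  have c: "w \<in> carrier_vec ?n" "x \<in> carrier_vec ?n" "y \<in> carrier_vec ?m" "yb \<in> carrier_vec ?m"
    "yb - y \<in> carrier_vec ?m" "rtilde P \<in> carrier_vec ?n" "btilde P \<in> carrier_vec ?m"
    using carr xV yb rtilde_carrier[OF data] btilde_carrier[OF data]
    by (auto simp: spaceV_def spaceZY_def)
  have e: "e \<in> carrier_vec ?m" using c(5) by (simp add: e_def)
  have R: "R \<in> carrier_vec ?n" unfolding R_def by (rule residual_carrier[OF data xV yb])
  have At: "Atilde P \<in> carrier_mat ?m ?n"
    using Atilde_adj_carrier by (simp add: Atilde_def)
  have Atv: "Atilde P *\<^sub>v (w + \<sigma> \<cdot>\<^sub>v R) \<in> carrier_vec ?m"
    using c R by (intro mult_mat_vec_carrier[OF At]) auto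
  have S2v: "S2 *\<^sub>v (yb - y) \<in> carrier_vec ?m"
    by (rule mult_mat_vec_carrier[OF S_carrier c(5)])
  have gr: "gr \<in> carrier_vec ?m"
    using c Atv S2v by (simp add: gr_def)
  have h: "h \<in> carrier_vec ?m" using gr by (simp add: h_def)
  have Ah: "?A *\<^sub>v h \<in> carrier_vec ?n" "?A *\<^sub>v yb \<in> carrier_vec ?n"
    using mult_mat_vec_carrier[OF Atilde_adj_carrier h] mult_mat_vec_carrier[OF Atilde_adj_carrier c(4)] .
  have val: "aug_lagrangian P \<sigma> x z w + ereal (1 / 2 * (op_norm S2 (z - y))\<^sup>2) = ereal (q z)"
    if "z \<in> carrier_vec ?m" for z
    using carr(1) that c ip_nonneg[of "z - y"] unfolding aug_lagrangian_def q_def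
    by (simp add: indicator_fun_def op_norm_def ip_def)
  have adj: "(Atilde P *\<^sub>v v) \<bullet> h = v \<bullet> (?A *\<^sub>v h)" if "v \<in> carrier_vec ?n" for v
    unfolding Atilde_def using transpose_vec_mult_scalar[OF Atilde_adj_carrier h that] .
  have grh: "gr \<bullet> h = btilde P \<bullet> h + (w + \<sigma> \<cdot>\<^sub>v R) \<bullet> (?A *\<^sub>v h) + ip h (yb - y)"
  proof -
    have "gr \<bullet> h = btilde P \<bullet> h + (Atilde P *\<^sub>v (w + \<sigma> \<cdot>\<^sub>v R)) \<bullet> h + (S2 *\<^sub>v (yb - y)) \<bullet> h"
      unfolding gr_def using c Atv S2v h by (simp add: add_scalar_prod_distrib[where n = ?m])
    moreover have "(Atilde P *\<^sub>v (w + \<sigma> \<cdot>\<^sub>v R)) \<bullet> h = (w + \<sigma> \<cdot>\<^sub>v R) \<bullet> (?A *\<^sub>v h)"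
      using c R by (intro adj) auto
    ultimately show ?thesis
      using comm_scalar_prod[OF S2v h] by (simp add: ip_def)
  qed
  have "0 \<le> gr \<bullet> h"
  proof (rule first_order_nonneg)
    fix t :: real assume "0 < t" "t \<le> 1"
    have p: "yb + t \<cdot>\<^sub>v h \<in> carrier_vec ?m" using c h by simp
    have Ap: "?A *\<^sub>v (yb + t \<cdot>\<^sub>v h) = ?A *\<^sub>v yb + t \<cdot>\<^sub>v (?A *\<^sub>v h)"
      using mult_add_distrib_mat_vec[OF Atilde_adj_carrier c(4), of "t \<cdot>\<^sub>v h"] h
        mult_mat_vec[OF Atilde_adj_carrier h] by simp
    have res: "residual P x (yb + t \<cdot>\<^sub>v h) = R + t \<cdot>\<^sub>v (?A *\<^sub>v h)"
      unfolding R_def residual_def Ap by (rule vec_shift[OF Ah(2,1) c(2,6)])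
    have dy: "yb + t \<cdot>\<^sub>v h - y = e + t \<cdot>\<^sub>v h"
      unfolding e_def using c h by (intro eq_vecI) auto
    have "\<not> ereal (q (yb + t \<cdot>\<^sub>v h)) < ereal (q yb)"
      using argmin p unfolding is_arg_min_def spaceZY_def val[OF p, symmetric] val[OF c(4), symmetric]
      by blast
    then have "q yb \<le> q (yb + t \<cdot>\<^sub>v h)" by simp
    also have "q (yb + t \<cdot>\<^sub>v h) = q yb + t * (gr \<bullet> h)
        + t\<^sup>2 * (\<sigma> / 2 * ((?A *\<^sub>v h) \<bullet> (?A *\<^sub>v h)) + 1 / 2 * ip h h)"
      unfolding q_def res dy R_def[symmetric] scalar_self_line[OF R Ah(1)] grh e_def[symmetric]
      using c(1-4,6,7) e R h Ah
      by (simp add: add_scalar_prod_distrib[where n = ?n] scalar_prod_add_distrib[where n = ?n]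
          scalar_prod_add_distrib[where n = ?m] ip_simps ip_commute[of e h])
        (simp add: algebra_simps power2_eq_square add_divide_distrib)
    finally show "0 \<le> t * (gr \<bullet> h) + t\<^sup>2 * (\<sigma> / 2 * ((?A *\<^sub>v h) \<bullet> (?A *\<^sub>v h)) + 1 / 2 * ip h h)"
      by simp
  qed
  then have "gr \<bullet> gr \<le> 0" using gr by (simp add: h_def)
  then show ?thesis
    using scalar_self_zeroD gr unfolding gr_def R_def by blast
qed


section \<open>The iteration as a resolvent step\<close>

lemma opS_mult:
  assumes S2: "S2 \<in> carrier_mat (dZ P + dY P) (dZ P + dY P)"
    and v: "v \<in> carrier_vec (dV P)" and x: "x \<in> carrier_vec (dZ P + dY P)"
    and w: "w \<in> carrier_vec (dV P)"
  shows "opS P \<sigma> \<mu>1 S2 *\<^sub>v (v @\<^sub>v x @\<^sub>v w) = (\<mu>1 \<cdot>\<^sub>v v)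
    @\<^sub>v (\<sigma> \<cdot>\<^sub>v (Atilde P *\<^sub>v (Atilde_adj P *\<^sub>v x)) + S2 *\<^sub>v x + Atilde P *\<^sub>v w)
    @\<^sub>v (Atilde_adj P *\<^sub>v x + inverse \<sigma> \<cdot>\<^sub>v w)"
proof -
  let ?n = "dV P" and ?m = "dZ P + dY P"
  let ?A = "Atilde_adj P"
  have A: "?A \<in> carrier_mat ?n ?m" by (rule Atilde_adj_carrier)
  have At: "Atilde P \<in> carrier_mat ?m ?n" using A by (simp add: Atilde_def)
  have AtA: "Atilde P * ?A \<in> carrier_mat ?m ?m" by (rule mult_carrier_mat[OF At A])
  have M: "\<sigma> \<cdot>\<^sub>m (Atilde P * ?A) + S2 \<in> carrier_mat ?m ?m" by (rule add_carrier_mat[OF S2])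
  have I: "c \<cdot>\<^sub>m 1\<^sub>m ?n \<in> carrier_mat ?n ?n" for c :: real by simp
  have "(\<sigma> \<cdot>\<^sub>m (Atilde P * ?A) + S2) *\<^sub>v x = \<sigma> \<cdot>\<^sub>v (Atilde P *\<^sub>v (?A *\<^sub>v x)) + S2 *\<^sub>v x"
    using add_mult_distrib_mat_vec[OF smult_carrier_mat[OF AtA] S2 x]
      smult_mult_vec[OF AtA x] assoc_mult_mat_vec[OF At A x] by simp
  moreover have "(c \<cdot>\<^sub>m 1\<^sub>m ?n) *\<^sub>v y = c \<cdot>\<^sub>v y" if "y \<in> carrier_vec ?n" for c :: real and y
    using smult_mult_vec[OF one_carrier_mat that] that by simp
  ultimately show ?thesis
    unfolding opS_def opS1_def
    using mult_mat_vec_split[OF I four_block_carrier_mat[OF M I] v append_carrier_vec[OF x w]]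
      four_block_mat_mult_vec[OF M At A I x w] v w
    by simp
qed

text \<open>Completing the square in the lower right block gives u \<bullet> S u = \<mu>1 |v|^2 + x
  \<bullet> S2 x + |w + \<sigma> A^* x|^2 / \<sigma>, where A^* is
  \<open>Atilde_adj P\<close>.\<close>

lemma opS_pos_def:
  assumes \<sigma>: "0 < \<sigma>" and \<mu>: "0 < \<mu>1" and S2: "pos_def (dZ P + dY P) S2"
  shows "pos_def (dV P + ((dZ P + dY P) + dV P)) (opS P \<sigma> \<mu>1 S2)"
proof -
  let ?n = "dV P" and ?m = "dZ P + dY P"
  let ?A = "Atilde_adj P" and ?S = "opS P \<sigma> \<mu>1 S2"
  have A: "?A \<in> carrier_mat ?n ?m" by (rule Atilde_adj_carrier)
  have At: "Atilde P \<in> carrier_mat ?m ?n" using A by (simp add: Atilde_def)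
  have AtA: "Atilde P * ?A \<in> carrier_mat ?m ?m" by (rule mult_carrier_mat[OF At A])
  have S2c: "S2 \<in> carrier_mat ?m ?m" "S2\<^sup>T = S2" using S2 by (auto simp: pos_def_def sym_mat_def)
  have M: "\<sigma> \<cdot>\<^sub>m (Atilde P * ?A) + S2 \<in> carrier_mat ?m ?m" by (rule add_carrier_mat[OF S2c(1)])
  have I: "c \<cdot>\<^sub>m 1\<^sub>m ?n \<in> carrier_mat ?n ?n" for c :: real by simp
  have IT: "(c \<cdot>\<^sub>m 1\<^sub>m ?n)\<^sup>T = c \<cdot>\<^sub>m 1\<^sub>m ?n" for c :: real by (intro eq_matI) auto
  have "pos_def ?m (\<sigma> \<cdot>\<^sub>m (Atilde P * ?A) + S2)"
  proof (rule pos_def_add[OF _ S2])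
    have "pos_semidef ?m (Atilde P * (Atilde P)\<^sup>T)" by (rule pos_semidef_mult_transpose[OF At])
    then show "pos_semidef ?m (\<sigma> \<cdot>\<^sub>m (Atilde P * ?A))"
      using \<sigma> pos_semidef_smult[of \<sigma>] by (simp add: Atilde_def)
  qed
  then have MT: "(\<sigma> \<cdot>\<^sub>m (Atilde P * ?A) + S2)\<^sup>T = \<sigma> \<cdot>\<^sub>m (Atilde P * ?A) + S2"
    by (simp add: pos_def_def sym_mat_def)
  have AT: "?A\<^sup>T = Atilde P" "(Atilde P)\<^sup>T = ?A" by (simp_all add: Atilde_def)
  have "?S\<^sup>T = ?S"
    unfolding opS_def opS1_def
      transpose_four_block_mat[OF I zero_carrier_mat zero_carrier_mat four_block_carrier_mat[OF M I]]
      transpose_four_block_mat[OF M At A I] MT AT IT zero_transpose_mat ..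
  moreover have "?S \<in> carrier_mat (?n + (?m + ?n)) (?n + (?m + ?n))"
    unfolding opS_def opS1_def by (rule four_block_carrier_mat[OF I four_block_carrier_mat[OF M I]])
  moreover have "0 < u \<bullet> (?S *\<^sub>v u)" if u: "u \<in> carrier_vec (?n + (?m + ?n))" "u \<noteq> 0\<^sub>v (?n + (?m + ?n))" for u
  proof -
    obtain v x w where uvw: "u = v @\<^sub>v x @\<^sub>v w"
      and v: "v \<in> carrier_vec ?n" and x: "x \<in> carrier_vec ?m" and w: "w \<in> carrier_vec ?n"
      using vec_first_last_append[OF u(1)] vec_first_last_append[OF vec_last_carrier[of u "?m + ?n"]]
      by (metis vec_first_carrier vec_last_carrier)
    have Ax: "?A *\<^sub>v x \<in> carrier_vec ?n" by (rule mult_mat_vec_carrier[OF A x])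
    have adj: "x \<bullet> (Atilde P *\<^sub>v y) = (?A *\<^sub>v x) \<bullet> y" if y: "y \<in> carrier_vec ?n" for y
      using transpose_vec_mult_scalar[OF At y x] by (simp add: AT)
    have Aty: "Atilde P *\<^sub>v y \<in> carrier_vec ?m" if y: "y \<in> carrier_vec ?n" for y
      by (rule mult_mat_vec_carrier[OF At y])
    have S2x: "S2 *\<^sub>v x \<in> carrier_vec ?m" by (rule mult_mat_vec_carrier[OF S2c(1) x])
    \<comment> \<open>The completed square: |y|^2 / \<sigma> absorbs both off-diagonal blocks and
      the term \<sigma> |A^* x|^2.\<close>
    define y where "y = w + \<sigma> \<cdot>\<^sub>v (?A *\<^sub>v x)"
    have "inverse \<sigma> * (y \<bullet> y) = inverse \<sigma> * (w \<bullet> w) + 2 * (w \<bullet> (?A *\<^sub>v x))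
        + \<sigma> * ((?A *\<^sub>v x) \<bullet> (?A *\<^sub>v x))"
      unfolding y_def scalar_self_line[OF w Ax] using \<sigma> by (simp add: field_simps power2_eq_square)
    moreover have "u \<bullet> (?S *\<^sub>v u) = \<mu>1 * (v \<bullet> v)
        + (x \<bullet> (\<sigma> \<cdot>\<^sub>v (Atilde P *\<^sub>v (?A *\<^sub>v x)) + S2 *\<^sub>v x + Atilde P *\<^sub>v w)
        + w \<bullet> (?A *\<^sub>v x + inverse \<sigma> \<cdot>\<^sub>v w))"
      unfolding uvw opS_mult[OF S2c(1) v x w]
      using v x w Ax Aty[OF w] Aty[OF Ax] S2x
      by (simp add: scalar_prod_append[where ?n1.0 = ?n and ?n2.0 = "?m + ?n"]
          scalar_prod_append[where ?n1.0 = ?m and ?n2.0 = ?n])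
    moreover have "x \<bullet> (\<sigma> \<cdot>\<^sub>v (Atilde P *\<^sub>v (?A *\<^sub>v x)) + S2 *\<^sub>v x + Atilde P *\<^sub>v w)
        = \<sigma> * ((?A *\<^sub>v x) \<bullet> (?A *\<^sub>v x)) + x \<bullet> (S2 *\<^sub>v x) + (?A *\<^sub>v x) \<bullet> w"
      using x Aty[OF w] Aty[OF Ax] S2x
      by (simp add: scalar_prod_add_distrib[where n = ?m] adj[OF w] adj[OF Ax])
    moreover have "w \<bullet> (?A *\<^sub>v x + inverse \<sigma> \<cdot>\<^sub>v w) = w \<bullet> (?A *\<^sub>v x) + inverse \<sigma> * (w \<bullet> w)"
      using w Ax by (simp add: scalar_prod_add_distrib[where n = ?n])
    ultimately have eq: "u \<bullet> (?S *\<^sub>v u)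
        = \<mu>1 * (v \<bullet> v) + x \<bullet> (S2 *\<^sub>v x) + inverse \<sigma> * (y \<bullet> y)"
      using comm_scalar_prod[OF Ax w] by simp
    have nn: "0 \<le> \<mu>1 * (v \<bullet> v)" "0 \<le> x \<bullet> (S2 *\<^sub>v x)" "0 \<le> inverse \<sigma> * (y \<bullet> y)"
      using \<mu> \<sigma> pos_def_imp_pos_semidef[OF S2] x by (simp_all add: scalar_self_nonneg pos_semidef_def)
    show ?thesis
    proof (rule ccontr)
      assume "\<not> ?thesis"
      then have z: "\<mu>1 * (v \<bullet> v) \<le> 0" "x \<bullet> (S2 *\<^sub>v x) \<le> 0" "inverse \<sigma> * (y \<bullet> y) \<le> 0"
        using eq nn by linarith+
      have v0: "v = 0\<^sub>v ?n"
        using z(1) \<mu> by (intro scalar_self_zeroD v) (simp add: mult_le_0_iff)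
      have x0: "x = 0\<^sub>v ?m"
        using z(2) S2 x by (force simp: pos_def_def)
      have A0: "?A *\<^sub>v 0\<^sub>v ?m = 0\<^sub>v ?n"
        using A by (intro eq_vecI) auto
      \<comment> \<open>Once x vanishes, the completed square is |w|^2 / \<sigma>, so w vanishes
        too.\<close>
      have "w = y" unfolding y_def x0 A0 using w by (intro eq_vecI) auto
      then have w0: "w = 0\<^sub>v ?n"
        using z(3) \<sigma> w by (intro scalar_self_zeroD) (simp_all add: mult_le_0_iff)
      have "u = 0\<^sub>v (?n + (?m + ?n))" unfolding uvw v0 x0 w0 by (intro eq_vecI) auto
      then show False using u(2) by simp
    qed
  qed
  ultimately show ?thesis by (simp add: pos_def_def sym_mat_def)
qed

section \<open>Monotonicity of the KKT operator and its resolvent\<close>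

lemma opT_carrier:
  assumes data: "problem_data P" and t: "t \<in> opT P u"
  shows "t \<in> spaceU P"
proof -
  from t obtain v x w g where t: "t = (g + w) @\<^sub>v (btilde P + Atilde P *\<^sub>v w)
      @\<^sub>v (rtilde P - Atilde_adj P *\<^sub>v x - v)"
    and c: "v \<in> carrier_vec (dV P)" "x \<in> carrier_vec (dZ P + dY P)" "w \<in> carrier_vec (dV P)"
      "g \<in> carrier_vec (dV P)"
    by (auto simp: opT_def spaceV_def spaceZY_def subdifferential_def)
  have "Atilde P \<in> carrier_mat (dZ P + dY P) (dV P)"
    using Atilde_adj_carrier by (simp add: Atilde_def)
  from mult_mat_vec_carrier[OF this c(3)] mult_mat_vec_carrier[OF Atilde_adj_carrier c(2)] c
    rtilde_carrier[OF data] btilde_carrier[OF data]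
  show ?thesis unfolding t spaceU_def by (intro append_carrier_vec) auto
qed

text \<open>A subgradient of the indicator is a normal vector. An infinite value at v would violate
  the subgradient inequality at a point of \<Gamma>, where the indicator is 0.\<close>

lemma subdifferential_indicator_GamD:
  assumes g: "g \<in> subdifferential (dV P) (indicator_fun (Gam P)) v"
  shows "v \<in> Gam P" and "y \<in> Gam P \<Longrightarrow> g \<bullet> (y - v) \<le> 0"
proof -
  have ineq: "indicator_fun (Gam P) v + ereal (g \<bullet> (y - v)) \<le> indicator_fun (Gam P) y"
    if "y \<in> Gam P" for y
    using g GamD[OF that] unfolding subdifferential_def by blast
  obtain z where z: "z \<in> Gam P" using Gam_nonempty by blast
  show v: "v \<in> Gam P"
    using ineq[OF z] z by (auto simp: indicator_fun_def split: if_splits)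
  show "g \<bullet> (y - v) \<le> 0" if "y \<in> Gam P"
    using ineq[OF that] that v by (simp add: indicator_fun_def zero_ereal_def)
qed

text \<open>T is the sum of a normal cone in the first component and an affine map with skew-adjoint
  linear part. The latter contributes nothing to the pairing, and normal cones are monotone.\<close>

lemma opT_monotone:
  assumes data: "problem_data P" and t: "t \<in> opT P u" and t': "t' \<in> opT P u'"
  shows "0 \<le> (u - u') \<bullet> (t - t')"
proof -
  let ?n = "dV P" and ?m = "dZ P + dY P"
  let ?A = "Atilde_adj P"
  from t obtain v x w g where t: "t = (g + w) @\<^sub>v (btilde P + Atilde P *\<^sub>v w)
      @\<^sub>v (rtilde P - ?A *\<^sub>v x - v)" and u: "u = v @\<^sub>v x @\<^sub>v w"
    and c: "v \<in> carrier_vec ?n" "x \<in> carrier_vec ?m" "w \<in> carrier_vec ?n" "g \<in> carrier_vec ?n"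
    and g: "g \<in> subdifferential ?n (indicator_fun (Gam P)) v"
    by (auto simp: opT_def spaceV_def spaceZY_def subdifferential_def)
  from t' obtain v' x' w' g' where t': "t' = (g' + w') @\<^sub>v (btilde P + Atilde P *\<^sub>v w')
      @\<^sub>v (rtilde P - ?A *\<^sub>v x' - v')" and u': "u' = v' @\<^sub>v x' @\<^sub>v w'"
    and c': "v' \<in> carrier_vec ?n" "x' \<in> carrier_vec ?m" "w' \<in> carrier_vec ?n" "g' \<in> carrier_vec ?n"
    and g': "g' \<in> subdifferential ?n (indicator_fun (Gam P)) v'"
    by (auto simp: opT_def spaceV_def spaceZY_def subdifferential_def)
  note A = Atilde_adj_carrier[of P]
  have At: "Atilde P \<in> carrier_mat ?m ?n" using A by (simp add: Atilde_def)
  have r: "rtilde P \<in> carrier_vec ?n" and b: "btilde P \<in> carrier_vec ?m"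
    using rtilde_carrier[OF data] btilde_carrier[OF data] .
  define dv where "dv = v - v'"
  define dx where "dx = x - x'"
  define dw where "dw = w - w'"
  have d: "dv \<in> carrier_vec ?n" "dx \<in> carrier_vec ?m" "dw \<in> carrier_vec ?n" "g - g' \<in> carrier_vec ?n"
    using c c' by (simp_all add: dv_def dx_def dw_def)
  note mv = mult_mat_vec_carrier[OF A] mult_mat_vec_carrier[OF At]
  have du: "u - u' = dv @\<^sub>v dx @\<^sub>v dw"
    unfolding u u' dv_def dx_def dw_def using c c'
    by (simp add: append_vec_diff[where n = ?n and m = "?m + ?n"] append_vec_diff[where n = ?m and m = ?n])
  have e1: "g + w - (g' + w') = (g - g') + dw"
    unfolding dw_def using c c' by (intro eq_vecI) auto
  have e2: "btilde P + Atilde P *\<^sub>v w - (btilde P + Atilde P *\<^sub>v w') = Atilde P *\<^sub>v dw"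
    unfolding dw_def mult_minus_distrib_mat_vec[OF At c(3) c'(3)]
    using b mv(2)[OF c(3)] mv(2)[OF c'(3)] carrier_matD(1)[OF A] carrier_matD(1)[OF At]
    by (intro eq_vecI) (auto simp del: index_mult_mat_vec)
  have e3: "rtilde P - ?A *\<^sub>v x - v - (rtilde P - ?A *\<^sub>v x' - v') = - (?A *\<^sub>v dx) - dv"
    unfolding dx_def dv_def mult_minus_distrib_mat_vec[OF A c(2) c'(2)]
    using r mv(1)[OF c(2)] mv(1)[OF c'(2)] c(1) c'(1)
      carrier_matD(1)[OF A] carrier_matD(1)[OF At]
    by (intro eq_vecI) (auto simp del: index_mult_mat_vec)
  have dt: "t - t' = ((g - g') + dw) @\<^sub>v (Atilde P *\<^sub>v dw) @\<^sub>v (- (?A *\<^sub>v dx) - dv)"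
    unfolding t t' e1[symmetric] e2[symmetric] e3[symmetric]
    using c c' b r mv(2)[OF c(3)] mv(2)[OF c'(3)] mv(1)[OF c(2)] mv(1)[OF c'(2)]
    by (simp add: append_vec_diff[where n = ?n and m = "?m + ?n"] append_vec_diff[where n = ?m and m = ?n])
  have "dx \<bullet> (Atilde P *\<^sub>v dw) = (?A *\<^sub>v dx) \<bullet> dw"
    using transpose_vec_mult_scalar[OF At d(3,2)] by (simp add: Atilde_def)
  \<comment> \<open>The coupling terms cancel in pairs: \<open>dv\<close> with \<open>dw\<close>,
    and \<open>dx\<close> with \<open>dw\<close> through the adjoint.\<close>
  then have "(u - u') \<bullet> (t - t') = dv \<bullet> (g - g')"
    unfolding du dt using d mv(1)[OF d(2)] mv(2)[OF d(3)] carrier_matD(1)[OF A]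
    by (simp add: scalar_prod_append[where ?n1.0 = ?n and ?n2.0 = "?m + ?n"]
        scalar_prod_append[where ?n1.0 = ?m and ?n2.0 = ?n] scalar_prod_add_distrib[where n = ?n]
        scalar_prod_minus_distrib[where n = ?n] comm_scalar_prod[of dw ?n])
  \<comment> \<open>The form in which each normal vector is tested at the base point of the
    other.\<close>
  also have "\<dots> = - (g \<bullet> (v' - v)) - g' \<bullet> (v - v')"
    unfolding dv_def using c c'
    by (simp add: minus_scalar_prod_distrib[where n = ?n] scalar_prod_minus_distrib[where n = ?n]
        comm_scalar_prod[of v ?n] comm_scalar_prod[of v' ?n])
  also have "\<dots> \<ge> 0"
    using subdifferential_indicator_GamD[OF g] subdifferential_indicator_GamD[OF g'] by fastforce
  finally show ?thesis .
qed

text \<open>The description \<open>THE\<close> in \<open>resolvent\<close> requires uniqueness. For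
  two solutions the elements of T differ by -S(w' - w), so monotonicity bounds the S-form of w' - w
  by 0 and definiteness gives w' = w. Existence is supplied by \<open>incl\<close>, so no maximality
  argument enters.\<close>

lemma resolvent_eqI:
  assumes data: "problem_data P" and S: "pos_def (dV P + ((dZ P + dY P) + dV P)) S"
    and y: "y \<in> spaceU P" and w: "w \<in> spaceU P" and incl: "y - S *\<^sub>v w \<in> opT P w"
  shows "resolvent P S y = w"
  unfolding resolvent_def
proof (rule the_equality)
  let ?d = "dV P + ((dZ P + dY P) + dV P)"
  note Sc = pos_def_carrier[OF S]
  have c: "y \<in> carrier_vec ?d" "w \<in> carrier_vec ?d" "S *\<^sub>v w \<in> carrier_vec ?d"
    using y w mult_mat_vec_carrier[OF Sc, of w] by (auto simp: spaceU_def)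
  show "w \<in> spaceU P \<and> (\<exists>t\<in>opT P w. y = S *\<^sub>v w + t)"
  proof (intro conjI bexI[of _ "y - S *\<^sub>v w"])
    show "y = S *\<^sub>v w + (y - S *\<^sub>v w)"
      using c carrier_matD(1)[OF Sc] by (intro eq_vecI) (auto simp del: index_mult_mat_vec)
  qed (use w incl in auto)
  fix w' assume "w' \<in> spaceU P \<and> (\<exists>t\<in>opT P w'. y = S *\<^sub>v w' + t)"
  then obtain t where w': "w' \<in> carrier_vec ?d" and t: "t \<in> opT P w'" and yt: "y = S *\<^sub>v w' + t"
    by (auto simp: spaceU_def)
  have c': "t \<in> carrier_vec ?d" "S *\<^sub>v w' \<in> carrier_vec ?d"
    using opT_carrier[OF data t] mult_mat_vec_carrier[OF Sc w'] by (auto simp: spaceU_def)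
  have "t - (y - S *\<^sub>v w) = - (S *\<^sub>v (w' - w))"
    unfolding yt mult_minus_distrib_mat_vec[OF Sc w' c(2)]
    using c c' carrier_matD(1)[OF Sc]
    by (intro eq_vecI) (auto simp del: index_mult_mat_vec)
  then have "0 \<le> (w' - w) \<bullet> (- (S *\<^sub>v (w' - w)))"
    using opT_monotone[OF data t incl] by simp
  moreover have d: "w' - w \<in> carrier_vec ?d" using w' c by simp
  moreover have "(w' - w) \<bullet> (- (S *\<^sub>v (w' - w))) = - ((w' - w) \<bullet> (S *\<^sub>v (w' - w)))"
    by (rule scalar_prod_uminus_right)
      (simp only: carrier_vecD[OF d] carrier_vecD[OF mult_mat_vec_carrier[OF Sc d]])
  ultimately have "(w' - w) \<bullet> (S *\<^sub>v (w' - w)) \<le> 0" by simp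
  then have "w' - w = 0\<^sub>v ?d" using S d by (force simp: pos_def_def)
  then have "w' - w + w = w" using c by simp
  moreover have "w' - w + w = w'" using w' c by (intro eq_vecI) auto
  ultimately show "w' = w" by simp
qed

text \<open>The blocks of S are shaped to match one sweep: the first component is optimality of the
  first subproblem, the third is the multiplier update, the second is optimality in \<xi>. The
  off-diagonal blocks arise because the multiplier is updated with the old \<xi>.\<close>

lemma admm_step_inclusion:
  assumes data: "problem_data P" and \<sigma>: "0 < \<sigma>" and \<mu>: "0 < \<mu>1"
    and S2: "pos_def (dZ P + dY P) S2"
    and carr: "x \<in> spaceV P" "y \<in> spaceZY P" "w \<in> spaceV P"
    and xb: "is_arg_min
        (\<lambda>z. aug_lagrangian P \<sigma> z y w + ereal (1 / 2 * (op_norm (opS1 P \<mu>1) (z - x))\<^sup>2))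
        (\<lambda>z. z \<in> spaceV P) xb"
    and wb: "wb = w + \<sigma> \<cdot>\<^sub>v (Atilde_adj P *\<^sub>v y + xb - rtilde P)"
    and yb: "is_arg_min
        (\<lambda>z. aug_lagrangian P \<sigma> xb z wb + ereal (1 / 2 * (op_norm S2 (z - y))\<^sup>2))
        (\<lambda>z. z \<in> spaceZY P) yb"
  shows "xb @\<^sub>v yb @\<^sub>v wb \<in> spaceU P"
    and "opS P \<sigma> \<mu>1 S2 *\<^sub>v ((x @\<^sub>v y @\<^sub>v w) - (xb @\<^sub>v yb @\<^sub>v wb)) \<in> opT P (xb @\<^sub>v yb @\<^sub>v wb)"
proof -
  let ?n = "dV P" and ?m = "dZ P + dY P"
  let ?A = "Atilde_adj P"
  define g where "g = \<mu>1 \<cdot>\<^sub>v (x - xb) - wb"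
  have G: "xb \<in> Gam P" and g: "g \<in> subdifferential ?n (indicator_fun (Gam P)) xb"
    using primal_step_optimality[OF data \<mu> carr xb] unfolding g_def wb residual_def by auto
  have c: "x \<in> carrier_vec ?n" "y \<in> carrier_vec ?m" "w \<in> carrier_vec ?n"
    "xb \<in> carrier_vec ?n" "yb \<in> carrier_vec ?m"
    using carr GamD[OF G] yb by (auto simp: spaceV_def spaceZY_def is_arg_min_def)
  note A = Atilde_adj_carrier[of P]
  have At: "Atilde P \<in> carrier_mat ?m ?n" using A by (simp add: Atilde_def)
  have S2c: "S2 \<in> carrier_mat ?m ?m" by (rule pos_def_carrier[OF S2])
  have r: "rtilde P \<in> carrier_vec ?n" and b: "btilde P \<in> carrier_vec ?m"
    using rtilde_carrier[OF data] btilde_carrier[OF data] .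
  have Ay: "?A *\<^sub>v y \<in> carrier_vec ?n" "?A *\<^sub>v yb \<in> carrier_vec ?n"
    using mult_mat_vec_carrier[OF A c(2)] mult_mat_vec_carrier[OF A c(5)] .
  have R: "?A *\<^sub>v y + xb - rtilde P \<in> carrier_vec ?n" "residual P xb yb \<in> carrier_vec ?n"
    using Ay c r by (simp_all add: residual_def)
  have wbc: "wb \<in> carrier_vec ?n" using c R by (simp add: wb)
  show "xb @\<^sub>v yb @\<^sub>v wb \<in> spaceU P"
    unfolding spaceU_def using c wbc by (intro append_carrier_vec)
  have d: "x - xb \<in> carrier_vec ?n" "y - yb \<in> carrier_vec ?m" "w - wb \<in> carrier_vec ?n"
    using c wbc by simp_all
  have diff: "(x @\<^sub>v y @\<^sub>v w) - (xb @\<^sub>v yb @\<^sub>v wb) = (x - xb) @\<^sub>v (y - yb) @\<^sub>v (w - wb)"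
    using c wbc
    by (simp add: append_vec_diff[where n = ?n and m = "?m + ?n"] append_vec_diff[where n = ?m and m = ?n])
  have first: "\<mu>1 \<cdot>\<^sub>v (x - xb) = g + wb"
    unfolding g_def using c wbc by (intro eq_vecI) auto
  have wdiff: "w - wb = - \<sigma> \<cdot>\<^sub>v (?A *\<^sub>v y + xb - rtilde P)"
    unfolding wb using c R carrier_matD(1)[OF A] carrier_matD(1)[OF At]
    by (intro eq_vecI) (auto simp del: index_mult_mat_vec)
  \<comment> \<open>By \<open>wdiff\<close> the second term is minus the residual at the old
    \<open>y\<close>; the first term moves it to \<open>yb\<close>.\<close>
  have third: "?A *\<^sub>v (y - yb) + inverse \<sigma> \<cdot>\<^sub>v (w - wb) = rtilde P - ?A *\<^sub>v yb - xb"
    unfolding wdiff mult_minus_distrib_mat_vec[OF A c(2,5)] smult_smult_assoc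
    using Ay c r \<sigma> carrier_matD(1)[OF A] carrier_matD(1)[OF At]
    by (intro eq_vecI) (auto simp del: index_mult_mat_vec)
  have second: "\<sigma> \<cdot>\<^sub>v (Atilde P *\<^sub>v (?A *\<^sub>v (y - yb))) + S2 *\<^sub>v (y - yb) + Atilde P *\<^sub>v (w - wb)
      = btilde P + Atilde P *\<^sub>v wb"
  proof -
    \<comment> \<open>The same shift from \<open>y\<close> to \<open>yb\<close>, scaled by \<sigma>.
      It produces exactly the penalty gradient in the optimality condition of the second
      subproblem.\<close>
    have "\<sigma> \<cdot>\<^sub>v (?A *\<^sub>v (y - yb)) + (w - wb) = - \<sigma> \<cdot>\<^sub>v residual P xb yb"
      unfolding wdiff mult_minus_distrib_mat_vec[OF A c(2,5)] residual_def
      using Ay c r carrier_matD(1)[OF A] carrier_matD(1)[OF At]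
      by (intro eq_vecI) (auto simp del: index_mult_mat_vec simp: algebra_simps)
    moreover have "Atilde P *\<^sub>v (\<sigma> \<cdot>\<^sub>v (?A *\<^sub>v (y - yb)) + (w - wb))
        = \<sigma> \<cdot>\<^sub>v (Atilde P *\<^sub>v (?A *\<^sub>v (y - yb))) + Atilde P *\<^sub>v (w - wb)"
      using mult_mat_vec_carrier[OF A d(2)] d(3)
      by (simp add: mult_add_distrib_mat_vec[OF At] mult_mat_vec[OF At])
    ultimately have 1: "\<sigma> \<cdot>\<^sub>v (Atilde P *\<^sub>v (?A *\<^sub>v (y - yb))) + Atilde P *\<^sub>v (w - wb)
        = - \<sigma> \<cdot>\<^sub>v (Atilde P *\<^sub>v residual P xb yb)"
      using mult_mat_vec[OF At R(2)] by metis
    have 2: "Atilde P *\<^sub>v (wb + \<sigma> \<cdot>\<^sub>v residual P xb yb)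
        = Atilde P *\<^sub>v wb + \<sigma> \<cdot>\<^sub>v (Atilde P *\<^sub>v residual P xb yb)"
      using R(2) wbc by (simp add: mult_add_distrib_mat_vec[OF At] mult_mat_vec[OF At])
    have 3: "btilde P + (Atilde P *\<^sub>v wb + \<sigma> \<cdot>\<^sub>v (Atilde P *\<^sub>v residual P xb yb)) + S2 *\<^sub>v (yb - y) = 0\<^sub>v ?m"
      using dual_step_optimality[OF data S2 G carr(2) _ yb] wbc unfolding 2 by (simp add: spaceV_def)
    \<comment> \<open>With opaque names for the matrix-vector products, the claim is a linear
      combination of \<open>1\<close> and \<open>3\<close> in each coordinate.\<close>
    define p where "p = \<sigma> \<cdot>\<^sub>v (Atilde P *\<^sub>v (?A *\<^sub>v (y - yb)))"
    define p' where "p' = Atilde P *\<^sub>v (w - wb)"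
    define s where "s = Atilde P *\<^sub>v residual P xb yb"
    define e where "e = Atilde P *\<^sub>v wb"
    define f where "f = S2 *\<^sub>v y"
    define fb where "fb = S2 *\<^sub>v yb"
    have pc: "p \<in> carrier_vec ?m" "p' \<in> carrier_vec ?m" "s \<in> carrier_vec ?m" "e \<in> carrier_vec ?m"
      "f \<in> carrier_vec ?m" "fb \<in> carrier_vec ?m"
      unfolding p_def p'_def s_def e_def f_def fb_def
      using mult_mat_vec_carrier[OF At mult_mat_vec_carrier[OF A d(2)]] mult_mat_vec_carrier[OF At d(3)]
        mult_mat_vec_carrier[OF At R(2)] mult_mat_vec_carrier[OF At wbc]
        mult_mat_vec_carrier[OF S2c c(2)] mult_mat_vec_carrier[OF S2c c(5)] by simp_all
    have "p + (f - fb) + p' = btilde P + e"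
    proof (rule eq_vecI)
      fix i assume "i < dim_vec (btilde P + e)"
      then have i: "i < ?m" using pc by simp
      have "p $ i + p' $ i = - \<sigma> * s $ i"
        using arg_cong[OF 1[folded p_def p'_def s_def], of "\<lambda>v. v $ i"] pc i by simp
      moreover have "btilde P $ i + (e $ i + \<sigma> * s $ i) + (fb $ i - f $ i) = 0"
        using arg_cong[OF 3[unfolded mult_minus_distrib_mat_vec[OF S2c c(5,2)], folded e_def s_def f_def fb_def],
            of "\<lambda>v. v $ i"] pc b i by simp
      ultimately show "(p + (f - fb) + p') $ i = (btilde P + e) $ i"
        using pc b i by simp
    qed (use pc b in simp)
    then show ?thesis
      unfolding p_def p'_def e_def f_def fb_def mult_minus_distrib_mat_vec[OF S2c c(2,5)] .
  qed
  show "opS P \<sigma> \<mu>1 S2 *\<^sub>v ((x @\<^sub>v y @\<^sub>v w) - (xb @\<^sub>v yb @\<^sub>v wb)) \<in> opT P (xb @\<^sub>v yb @\<^sub>v wb)"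
    unfolding diff opS_mult[OF S2c d] first second third opT_def spaceV_def spaceZY_def
    using c wbc g by blast
qed


section \<open>The rate for the accelerated scheme\<close>

theorem theorem3p6:
  fixes P :: problem
    and \<sigma> \<mu>0 \<mu>1 \<mu>2 \<mu>3 \<rho> :: real
    and S2 :: "real mat"
    and u u_bar u_hat vL vL_bar xi xi_bar ws ws_bar :: "nat \<Rightarrow> real vec"
  assumes data: "problem_data P" "standing_assumption P"
    and params: "\<sigma> > 0" "\<mu>0 > 0" "\<mu>1 > 0" "\<mu>2 > 0" "\<mu>3 > 0" "0 < \<rho>" "\<rho> \<le> 2"
    and S2: "S2 = opS2_i P \<sigma> \<mu>0 \<or> S2 = opS2_ii P \<sigma> \<mu>2 \<mu>3"
    and zeros: "zeros_T P \<noteq> {}"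
    and u_split: "\<And>k. vL k \<in> spaceV P" "\<And>k. xi k \<in> spaceZY P" "\<And>k. ws k \<in> spaceV P"
      "\<And>k. u k = vL k @\<^sub>v xi k @\<^sub>v ws k"
    and vL_bar: "\<And>k. is_arg_min
        (\<lambda>x. aug_lagrangian P \<sigma> x (xi k) (ws k)
               + ereal (1 / 2 * (op_norm (opS1 P \<mu>1) (x - vL k))\<^sup>2))
        (\<lambda>x. x \<in> spaceV P) (vL_bar k)"
    and ws_bar: "\<And>k. ws_bar k = ws k + \<sigma> \<cdot>\<^sub>v (Atilde_adj P *\<^sub>v xi k + vL_bar k - rtilde P)"
    and xi_bar: "\<And>k. is_arg_min
        (\<lambda>x. aug_lagrangian P \<sigma> (vL_bar k) x (ws_bar k)
               + ereal (1 / 2 * (op_norm S2 (x - xi k))\<^sup>2))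
        (\<lambda>x. x \<in> spaceZY P) (xi_bar k)"
    and u_bar: "\<And>k. u_bar k = vL_bar k @\<^sub>v xi_bar k @\<^sub>v ws_bar k"
    and u_hat: "\<And>k. u_hat (Suc k) = \<rho> \<cdot>\<^sub>v u_bar k + (1 - \<rho>) \<cdot>\<^sub>v u k"
    and u_Suc: "\<And>k. u (Suc k) =
        (1 / real (k + 2)) \<cdot>\<^sub>v u 0 + (real (k + 1) / real (k + 2)) \<cdot>\<^sub>v u_hat (Suc k)"
  shows "\<forall>k. \<forall>u_star \<in> zeros_T P.
    op_norm (opS P \<sigma> \<mu>1 S2) (u k - fixpoint_map P (opS P \<sigma> \<mu>1 S2) \<rho> (u k))
      \<le> 2 * op_norm (opS P \<sigma> \<mu>1 S2) (u 0 - u_star) / real (k + 1)"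
proof (intro allI ballI)
  fix k u_star assume star: "u_star \<in> zeros_T P"
  let ?d = "dV P + ((dZ P + dY P) + dV P)"
  define S where "S = opS P \<sigma> \<mu>1 S2"
  have S2_pd: "pos_def (dZ P + dY P) S2"
    using S2 opS2_i_pos_def opS2_ii_pos_def params by blast
  have S_pd: "pos_def ?d S"
    unfolding S_def by (rule opS_pos_def[OF params(1,3) S2_pd])
  interpret psd_form ?d S
    by unfold_locales (rule pos_def_imp_pos_semidef[OF S_pd])
  note step = admm_step_inclusion[OF data(1) params(1,3) S2_pd u_split(1-3) vL_bar ws_bar xi_bar]
  have ub: "u_bar j \<in> carrier_vec ?d" for j
    using step(1)[of j] by (simp add: u_bar spaceU_def)
  have incl: "S *\<^sub>v (u j - u_bar j) \<in> opT P (u_bar j)" for j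
    using step(2)[of j] by (simp add: u_bar u_split(4) S_def)
  have u: "u j \<in> carrier_vec ?d" for j
    using u_split(1-3)[of j] unfolding u_split(4) spaceV_def spaceZY_def by (intro append_carrier_vec)
  have y: "u_hat (Suc j) \<in> carrier_vec ?d" for j
    using u ub by (simp add: u_hat)
  have p: "u_star \<in> carrier_vec ?d" and p0: "0\<^sub>v ?d \<in> opT P u_star"
    using star by (auto simp: zeros_T_def spaceU_def)
  \<comment> \<open>Firm nonexpansiveness in the S-form is monotonicity of T applied to two
    instances of \<open>incl\<close>.\<close>
  have firm: "0 \<le> ip (u_bar i - u_bar j) ((u i - u_bar i) - (u j - u_bar j))" for i j
  proof -
    have c: "u i - u_bar i \<in> carrier_vec ?d" "u j - u_bar j \<in> carrier_vec ?d" using u ub by auto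
    show ?thesis
      unfolding ip_def mult_minus_distrib_mat_vec[OF S_carrier c]
      by (rule opT_monotone[OF data(1) incl incl])
  qed
  \<comment> \<open>A zero of T is its own resolvent value. The difference
    \<open>u_star - u_star\<close> is kept so that the fact has the shape of \<open>firm\<close> in
    \<open>relaxation_nonexpansive\<close>; \<open>fix_star\<close> serves the same purpose for the
    relaxed point.\<close>
  have firm_star: "0 \<le> ip (u_bar j - u_star) ((u j - u_bar j) - (u_star - u_star))" for j
  proof -
    have c: "u j - u_bar j \<in> carrier_vec ?d" using u ub by auto
    have "u j - u_bar j - (u_star - u_star) = u j - u_bar j" using c p by (intro eq_vecI) auto
    moreover have "S *\<^sub>v (u j - u_bar j) - 0\<^sub>v ?d = S *\<^sub>v (u j - u_bar j)"
      using mult_mat_vec_carrier[OF S_carrier c] by simp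
    ultimately show ?thesis
      using opT_monotone[OF data(1) incl[of j] p0] by (simp add: ip_def)
  qed
  have fix_star: "u_star = \<rho> \<cdot>\<^sub>v u_star + (1 - \<rho>) \<cdot>\<^sub>v u_star"
    using p by (intro eq_vecI) (auto simp: algebra_simps)
  \<comment> \<open>This identifies \<open>u_bar k\<close> as the resolvent value at
    \<open>u k\<close>, hence \<open>u_hat (Suc k)\<close> as F(u^k).\<close>
  have "S *\<^sub>v u k - S *\<^sub>v u_bar k \<in> opT P (u_bar k)"
    using incl[of k] by (simp only: mult_minus_distrib_mat_vec[OF S_carrier u ub])
  then have "resolvent P S (S *\<^sub>v u k) = u_bar k"
    using mult_mat_vec_carrier[OF S_carrier u] ub
    by (intro resolvent_eqI[OF data(1) S_pd]) (simp_all add: spaceU_def)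
  then have F: "fixpoint_map P S \<rho> (u k) = u_hat (Suc k)"
    unfolding fixpoint_map_def u_hat using u ub by (simp add: comm_add_vec[where n = ?d])
  have "op_norm S (u k - u_hat (Suc k)) \<le> 2 * op_norm S (u 0 - u_star) / real (k + 1)"
  \<comment> \<open>The Halpern sequence \<open>y j\<close> is \<open>u_hat (Suc j)\<close>, shifted
    by one because \<open>u_hat 0\<close> is unspecified.\<close>
  proof (rule halpern_rate[OF u y u_Suc _ p])
    show "ip (u_hat (Suc (Suc j)) - u_hat (Suc j)) (u_hat (Suc (Suc j)) - u_hat (Suc j))
        \<le> ip (u (Suc j) - u j) (u (Suc j) - u j)" for j
      by (rule relaxation_nonexpansive[OF u u ub ub firm params(6,7) u_hat u_hat])
    show "ip (u_hat (Suc k) - u_star) (u_hat (Suc k) - u_star) \<le> ip (u k - u_star) (u k - u_star)"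
      by (rule relaxation_nonexpansive[OF u p ub p firm_star params(6,7) u_hat fix_star])
  qed
  then show "op_norm (opS P \<sigma> \<mu>1 S2) (u k - fixpoint_map P (opS P \<sigma> \<mu>1 S2) \<rho> (u k))
      \<le> 2 * op_norm (opS P \<sigma> \<mu>1 S2) (u 0 - u_star) / real (k + 1)"
    using F by (simp add: S_def)
qed

end
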